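(* Let $W$ be a representation of a semigroup $\Sigma$ that splits as a direct sum of pairwise non-isomorphic indecomposable subrepresentations. Let $\lambda_0<\lambda_1$. Then, in the space of continuously differentiable curves $L:(\lambda_0,\lambda_1)\to\mathrm{End}(W)$ with the $C^1$-topology, the set of curves in general position is open and dense.
   Context: A representation of a semigroup $\Sigma$ in a finite-dimensional real vector space $W$ is a map $\sigma\mapsto A_\sigma\in\mathfrak{gl}(W)$ with $A_\sigma A_\tau=A_{\sigma\tau}$; subrepresentations are invariant subspaces; $W\neq0$ is indecomposable if it is not a direct sum of two nonzero subrepresentations; $\mathrm{End}(U)$ is the algebra of linear maps commuting with the action and $\mathrm{End}^{\mathrm{Nil}}(U)$ its nilpotent elements. An indecomposable $U$ is absolutely indecomposable (of real type) if $\mathrm{End}(U)/\mathrm{End}^{\mathrm{Nil}}(U)\cong\mathbb{R}$ (i.e. has dimension $1$). For $L\in\mathrm{End}(W)$, $L^S$ is its semisimple part and $\ker L^S$ its generalized kernel (a subrepresentation). A curve $\lambda\mapsto L(\lambda)$ is in general position if for each $\lambda\in(\lambda_0,\lambda_1)$ either $L(\lambda)$ is invertible or $\ker L(\lambda)^S$ is absolutely indecomposable. *)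

theory Defs
  imports "HOL-Analysis.Analysis"
begin

text \<open>A representation of a semigroup (elements of type 'a) on W = real^'n,
  given by matrices A \<sigma>.\<close>

definition is_rep :: "('a::semigroup_mult \<Rightarrow> real^'n^'n) \<Rightarrow> bool" where
  "is_rep A \<longleftrightarrow> (\<forall>\<sigma> \<tau>. A (\<sigma> * \<tau>) = A \<sigma> ** A \<tau>)"

definition subrep :: "('a \<Rightarrow> real^'n^'n) \<Rightarrow> (real^'n) set \<Rightarrow> bool" where
  "subrep A V \<longleftrightarrow> subspace V \<and> (\<forall>\<sigma>. \<forall>v\<in>V. A \<sigma> *v v \<in> V)"

definition indecomposable :: "('a \<Rightarrow> real^'n^'n) \<Rightarrow> (real^'n) set \<Rightarrow> bool" where
  "indecomposable A U \<longleftrightarrow> subrep A U \<and> U \<noteq> {0} \<and>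
     \<not> (\<exists>V1 V2. subrep A V1 \<and> subrep A V2 \<and> V1 \<noteq> {0} \<and> V2 \<noteq> {0} \<and>
            V1 \<inter> V2 = {0} \<and> {x + y | x y. x \<in> V1 \<and> y \<in> V2} = U)"

text \<open>Isomorphism of subrepresentations: a linear bijection intertwining the action.\<close>
definition rep_iso :: "('a \<Rightarrow> real^'n^'n) \<Rightarrow> (real^'n) set \<Rightarrow> (real^'n) set \<Rightarrow> bool" where
  "rep_iso A U V \<longleftrightarrow> (\<exists>f. linear f \<and> bij_betw f U V \<and>
      (\<forall>\<sigma>. \<forall>u\<in>U. f (A \<sigma> *v u) = A \<sigma> *v f u))"

text \<open>W is the internal direct sum of U 0, ..., U (k-1).\<close>
definition internal_direct_sum :: "(nat \<Rightarrow> (real^'n) set) \<Rightarrow> nat \<Rightarrow> bool" where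
  "internal_direct_sum U k \<longleftrightarrow> (\<forall>w::real^'n. \<exists>!u. (\<forall>i<k. u i \<in> U i) \<and> (\<forall>i\<ge>k. u i = 0)
      \<and> w = (\<Sum>i<k. u i))"

text \<open>End(U): linear maps of U commuting with the action (represented by linear maps on W
  mapping U into U; only their restriction to U matters).\<close>
definition EndRep :: "('a \<Rightarrow> real^'n^'n) \<Rightarrow> (real^'n) set \<Rightarrow> (real^'n \<Rightarrow> real^'n) set" where
  "EndRep A U = {f. linear f \<and> f ` U \<subseteq> U \<and> (\<forall>\<sigma>. \<forall>u\<in>U. f (A \<sigma> *v u) = A \<sigma> *v f u)}"

definition NilEnd :: "('a \<Rightarrow> real^'n^'n) \<Rightarrow> (real^'n) set \<Rightarrow> (real^'n \<Rightarrow> real^'n) set" where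
  "NilEnd A U = {f \<in> EndRep A U. \<exists>m. \<forall>u\<in>U. (f ^^ m) u = 0}"

text \<open>Absolutely indecomposable: indecomposable, and End(U)/End^Nil(U) is a one-dimensional
  real vector space (End^Nil(U) is a linear subspace of End(U) and the quotient is spanned by
  the class of a single non-nilpotent endomorphism).\<close>
definition abs_indecomposable :: "('a \<Rightarrow> real^'n^'n) \<Rightarrow> (real^'n) set \<Rightarrow> bool" where
  "abs_indecomposable A U \<longleftrightarrow> indecomposable A U \<and>
     (\<forall>f\<in>NilEnd A U. \<forall>g\<in>NilEnd A U. \<forall>c::real. (\<lambda>x. f x + c *\<^sub>R g x) \<in> NilEnd A U) \<and>
     (\<exists>e\<in>EndRep A U. e \<notin> NilEnd A U \<and>
        (\<forall>f\<in>EndRep A U. \<exists>c::real. (\<lambda>x. f x - c *\<^sub>R e x) \<in> NilEnd A U))"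

text \<open>End(W): the commutant of the representation.\<close>
definition EndW :: "('a \<Rightarrow> real^'n^'n) \<Rightarrow> (real^'n^'n) set" where
  "EndW A = {L. \<forall>\<sigma>. L ** A \<sigma> = A \<sigma> ** L}"

text \<open>Generalized kernel of L (= kernel of the semisimple part L^S).\<close>
definition gen_ker :: "real^'n^'n \<Rightarrow> (real^'n) set" where
  "gen_ker L = {v. \<exists>m. (((*v) L) ^^ m) v = 0}"

definition general_position ::
  "('a \<Rightarrow> real^'n^'n) \<Rightarrow> real \<Rightarrow> real \<Rightarrow> (real \<Rightarrow> real^'n^'n) \<Rightarrow> bool" where
  "general_position A l0 l1 L \<longleftrightarrow>
     (\<forall>t\<in>{l0<..<l1}. invertible (L t) \<or> abs_indecomposable A (gen_ker (L t)))"

text \<open>Continuously differentiable curves (l0,l1) -> End(W).\<close>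
definition C1_curve :: "('a \<Rightarrow> real^'n^'n) \<Rightarrow> real \<Rightarrow> real \<Rightarrow> (real \<Rightarrow> real^'n^'n) \<Rightarrow> bool" where
  "C1_curve A l0 l1 L \<longleftrightarrow>
     (\<forall>t\<in>{l0<..<l1}. L t \<in> EndW A) \<and>
     (\<exists>L'. (\<forall>t\<in>{l0<..<l1}. (L has_vector_derivative L' t) (at t)) \<and> continuous_on {l0<..<l1} L')"

text \<open>Basic neighbourhoods of the (strong/Whitney) C^1 topology on curves over (l0,l1):
  values and derivatives within a positive continuous error function delta.\<close>
definition C1_nbhd :: "real \<Rightarrow> real \<Rightarrow> (real \<Rightarrow> real^'n^'n) \<Rightarrow> (real \<Rightarrow> real)
    \<Rightarrow> (real \<Rightarrow> real^'n^'n) set" where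
  "C1_nbhd l0 l1 L \<delta> = {M. \<forall>t\<in>{l0<..<l1}. norm (M t - L t) < \<delta> t \<and>
      norm (vector_derivative M (at t) - vector_derivative L (at t)) < \<delta> t}"

definition pos_cont :: "real \<Rightarrow> real \<Rightarrow> (real \<Rightarrow> real) \<Rightarrow> bool" where
  "pos_cont l0 l1 \<delta> \<longleftrightarrow> continuous_on {l0<..<l1} \<delta> \<and> (\<forall>t\<in>{l0<..<l1}. 0 < \<delta> t)"

end

theory Submission
  imports Defs
begin

text \<open>By Fitting's lemma each \<open>End(U i)\<close> is local, and since the \<open>U i\<close> are pairwise
  non-isomorphic, the \<open>L \<in> End(W)\<close> whose \<open>i\<close>-th diagonal block is nilpotent form a completely prime
  ideal \<open>P i\<close>. The generalized kernel of \<open>L\<close> is the sum of copies of those \<open>U i\<close> with \<open>L \<in> P i\<close>,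
  so \<open>L\<close> is bad exactly when it lies in some \<open>P i \<inter> P j\<close> with \<open>i \<noteq> j\<close>, or in some \<open>P i\<close> for which
  \<open>U i\<close> is not absolutely indecomposable. These finitely many subspaces are closed and have
  codimension at least 2 in \<open>End(W)\<close>. Closedness gives openness. For density, let
  \<open>\<phi> > 0\<close> be a \<open>C\<^sup>1\<close> function which is small together with its derivative and \<open>l\<close> a linear map to
  the plane vanishing on a bad subspace: \<open>L + \<phi> v\<close> avoids this subspace as soon as \<open>l v\<close> is
  not on the \<open>C\<^sup>1\<close> curve \<open>- l(L) / \<phi>\<close>, which is a null set in the plane.\<close>

section \<open>The commutant algebra\<close>

lemma matrix_add_rdistrib: "(X + Y) ** Z = X ** Z + Y ** Z" for X :: "real^'n^'m"
  by (simp add: matrix_matrix_mult_def vec_eq_iff sum.distrib distrib_right)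

lemma matrix_scaleR_left: "(c *\<^sub>R X) ** Y = c *\<^sub>R (X ** Y)" for X :: "real^'n^'m"
  by (simp add: matrix_matrix_mult_def vec_eq_iff sum_distrib_left mult.assoc)

lemma matrix_scaleR_right: "X ** (c *\<^sub>R Y) = c *\<^sub>R (X ** Y)" for X :: "real^'n^'m"
  by (simp add: matrix_matrix_mult_def vec_eq_iff sum_distrib_left mult.left_commute)

lemma subspace_EndW: "subspace (EndW A)"
  unfolding EndW_def subspace_def
  by (auto simp: matrix_add_ldistrib matrix_add_rdistrib matrix_scaleR_left matrix_scaleR_right)

lemmas matrix_act = matrix_vector_mul_assoc[symmetric] matrix_vector_mult_add_rdistrib
  matrix_vector_mult_diff_rdistrib matrix_vector_right_distrib matrix_vector_mult_diff_distrib
  matrix_vector_mult_scaleR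

lemma scaleR_matrix_act: "(c *\<^sub>R X) *v v = c *\<^sub>R (X *v v)" for X :: "real^'n^'m"
  by (simp add: matrix_vector_mult_def vec_eq_iff sum_distrib_left mult.assoc)

lemma sum_matrix_act: "(\<Sum>i\<in>I. X i) *v v = (\<Sum>i\<in>I. X i *v v)" for X :: "'i \<Rightarrow> real^'n^'m"
  by (induction I rule: infinite_finite_induct) (auto simp: matrix_vector_mult_add_rdistrib)

lemma matrix_act_sum: "X *v (\<Sum>i\<in>I. w i) = (\<Sum>i\<in>I. X *v w i)" for X :: "real^'n^'m"
  by (rule linear_sum) simp

lemma EndW_iff: "L \<in> EndW A \<longleftrightarrow> (\<forall>\<sigma> v. L *v (A \<sigma> *v v) = A \<sigma> *v (L *v v))"
  by (auto simp: EndW_def matrix_eq matrix_act)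

lemma EndW_mat1: "mat 1 \<in> EndW A"
  by (simp add: EndW_iff)

lemma EndW_mult: "X \<in> EndW A \<Longrightarrow> Y \<in> EndW A \<Longrightarrow> X ** Y \<in> EndW A"
  by (simp add: EndW_iff matrix_act)

lemma EndW_inverse:
  assumes "X \<in> EndW A" "X ** Y = mat 1" "Y ** X = mat 1"
  shows "Y \<in> EndW A"
  unfolding EndW_def
proof (intro CollectI allI)
  fix \<sigma>
  have "Y ** A \<sigma> = Y ** (A \<sigma> ** X) ** Y"
    using assms(2) by (simp add: matrix_mul_assoc[symmetric])
  also have "\<dots> = Y ** (X ** A \<sigma>) ** Y"
    using assms(1) by (simp add: EndW_def)
  also have "\<dots> = A \<sigma> ** Y"
    using assms(3) by (simp add: matrix_mul_assoc)
  finally show "Y ** A \<sigma> = A \<sigma> ** Y" .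
qed

lemma EndW_injective_imp_inverse:
  assumes "X \<in> EndW A" "\<And>v. X *v v = 0 \<Longrightarrow> v = 0"
  obtains Y where "Y \<in> EndW A" "\<And>v. X *v (Y *v v) = v" "\<And>v. Y *v (X *v v) = v"
proof -
  obtain Y where Y: "Y ** X = mat 1"
    using assms(2) matrix_left_invertible_ker by blast
  then have Y': "X ** Y = mat 1"
    using matrix_left_right_inverse by blast
  show ?thesis
    by (rule that[OF EndW_inverse[OF assms(1) Y' Y]])
      (simp_all add: matrix_vector_mul_assoc Y Y')
qed

section \<open>Generalized kernels and the Fitting projection\<close>

lemma linear_funpow: "linear f \<Longrightarrow> linear (f ^^ m)" for f :: "'v::real_vector \<Rightarrow> 'v"
  by (induction m) (auto intro: linear_compose[unfolded o_def] simp: o_def linear_id[unfolded id_def] id_def)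

lemma injective_endomorphism_image_eq:
  fixes f :: "'v::euclidean_space \<Rightarrow> 'v"
  assumes f: "linear f" and S: "subspace S" "f ` S \<subseteq> S" and inj: "\<And>v. v \<in> S \<Longrightarrow> f v = 0 \<Longrightarrow> v = 0"
  shows "f ` S = S"
proof (rule subspace_dim_equal)
  have "inj_on f (span S)"
    using linear_inj_on_iff_eq_0[OF f, of S] S inj by (simp add: span_eq_iff[THEN iffD2])
  then show "dim S \<le> dim (f ` S)"
    using dim_image_eq[OF f] by simp
qed (use S f linear_subspace_image in auto)

text \<open>In \<open>gen_ker\<close> the exponent may depend on the vector. The sum of the
  exponents of a finite basis serves all vectors at once.\<close>

lemma gen_ker_exponent:
  obtains m where "\<And>v. v \<in> gen_ker L \<Longrightarrow> ((*v) L ^^ m) v = 0"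
proof -
  have lin: "linear ((*v) L ^^ m)" for m by (simp add: linear_funpow)
  obtain B where B: "B \<subseteq> gen_ker L" "independent B" "gen_ker L \<subseteq> span B"
    using maximal_independent_subset by blast
  have "\<forall>b\<in>B. \<exists>m. ((*v) L ^^ m) b = 0"
    using B(1) by (auto simp: gen_ker_def)
  then obtain m where m: "\<And>b. b \<in> B \<Longrightarrow> ((*v) L ^^ m b) b = 0"
    by metis
  have fin: "finite B" using B(2) by (rule independent_imp_finite)
  show ?thesis
  proof
    fix v assume "v \<in> gen_ker L"
    show "((*v) L ^^ sum m B) v = 0"
    proof (rule linear_eq_0_on_span[OF lin])
      fix b assume b: "b \<in> B"
      have "sum m B = sum m (B - {b}) + m b"
        using sum.remove[OF fin b, of m] by simp
      then show "((*v) L ^^ sum m B) b = 0"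
        using m[OF b] linear_0[OF lin] by (simp add: funpow_add)
    qed (use \<open>v \<in> gen_ker L\<close> B(3) in auto)
  qed
qed

text \<open>Fitting decomposition: for a large power \<open>T\<close> of \<open>L\<close>, the space
  is the direct sum of the kernel of \<open>T\<close>, which is \<open>gen_ker L\<close>, and the
  range of \<open>T\<close>. The projection \<open>f\<close> onto the first summand along the second
  is canonical, and therefore commutes with everything that commutes with \<open>L\<close>.\<close>

lemma fitting_projection:
  fixes L :: "real^'n^'n"
  obtains f where
    "\<And>B. B ** L = L ** B \<Longrightarrow> B ** f = f ** B"
    "\<And>v. f *v v \<in> gen_ker L" "\<And>v. v \<in> gen_ker L \<Longrightarrow> f *v v = v"
proof -
  obtain m where m: "\<And>v. v \<in> gen_ker L \<Longrightarrow> ((*v) L ^^ m) v = 0"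
    using gen_ker_exponent by blast
  define T where "T = ((*v) L ^^ m)"
  have lin: "linear T" by (simp add: T_def linear_funpow)
  \<comment> \<open>The kernels of the powers of \<open>L\<close> have stabilized at
    \<open>m\<close>, so \<open>T\<close> is injective on its range.\<close>
  have TT: "T w = 0" if "T (T w) = 0" for w
  proof -
    have "((*v) L ^^ (m + m)) w = 0" using that by (simp add: T_def funpow_add)
    then have "w \<in> gen_ker L" unfolding gen_ker_def by blast
    then show ?thesis using m by (simp add: T_def)
  qed
  have "T ` range T = range T"
    by (rule injective_endomorphism_image_eq[OF lin])
      (auto intro: TT linear_subspace_image[OF lin subspace_UNIV])
  then have "\<exists>z. T w = T (T z)" for w
    by (metis (no_types, lifting) image_iff rangeI)
  then obtain s where s: "\<And>w. T w = T (T (s w))" by metis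
  \<comment> \<open>The preimage \<open>s w\<close> is an arbitrary choice, but \<open>g w\<close>
    is the only element of the range of \<open>T\<close> with the same image under \<open>T\<close>
    as \<open>w\<close>. This uniqueness, stated next, yields both the linearity of \<open>g\<close>
    and its commutation with \<open>B\<close>.\<close>
  define g where "g w = T (s w)" for w
  have Tg: "T (g w) = T w" for w by (simp add: g_def s[symmetric])
  have g: "g w = T z" if "T (T z) = T w" for w z
  proof -
    have "T (T (s w - z)) = 0" using that s[of w] by (simp add: linear_diff[OF lin])
    from TT[OF this] show ?thesis by (simp add: g_def linear_diff[OF lin])
  qed
  have glin: "linear g"
  proof
    show "g (x + y) = g x + g y" for x y
      using g[of "s x + s y" "x + y"] s by (simp add: g_def linear_add[OF lin])
    show "g (c *\<^sub>R x) = c *\<^sub>R g x" for c x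
      using g[of "c *\<^sub>R s x" "c *\<^sub>R x"] s by (simp add: g_def linear_scale[OF lin])
  qed
  define f where "f = matrix (\<lambda>w. w - g w)"
  have f: "f *v w = w - g w" for w
    unfolding f_def by (rule matrix_works) (simp add: linear_matrix_vector_mul_eq linear_compose_sub linear_ident glin)
  show ?thesis
  proof
    fix B assume B: "B ** L = L ** B"
    have BT: "B *v T w = T (B *v w)" for w
    proof -
      have BL: "B *v (L *v w) = L *v (B *v w)" for w
        using B by (metis matrix_vector_mul_assoc)
      have "B *v ((*v) L ^^ j) w = ((*v) L ^^ j) (B *v w)" for j
        by (induction j) (simp_all add: BL)
      then show ?thesis by (simp add: T_def)
    qed
    have "g (B *v w) = B *v g w" for w
      using g[of "B *v s w" "B *v w"] s[of w] by (simp add: BT[symmetric] g_def)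
    then show "B ** f = f ** B"
      by (simp add: matrix_eq matrix_act f)
  next
    fix v
    have "T (f *v v) = 0" by (simp add: f linear_diff[OF lin] Tg)
    then show "f *v v \<in> gen_ker L" by (auto simp: gen_ker_def T_def)
    show "f *v v = v" if "v \<in> gen_ker L"
      using g[of 0 v] m[OF that] linear_0[OF lin] by (simp add: f T_def)
  qed
qed

text \<open>The components of a vector are unique. Since sums, multiples and images under
  \<open>A \<sigma>\<close> of components are again components, the component maps are linear and
  equivariant.\<close>

lemma direct_sum_projections:
  fixes A :: "'a \<Rightarrow> real^'n^'n"
  assumes sum: "internal_direct_sum U k" and sub: "\<And>i. i < k \<Longrightarrow> subrep A (U i)"
  obtains e where "\<And>i. i < k \<Longrightarrow> e i \<in> EndW A" "\<And>i w. i < k \<Longrightarrow> e i *v w \<in> U i"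
    "\<And>i v. i < k \<Longrightarrow> v \<in> U i \<Longrightarrow> e i *v v = v"
    "\<And>i j v. i < k \<Longrightarrow> j < k \<Longrightarrow> i \<noteq> j \<Longrightarrow> v \<in> U j \<Longrightarrow> e i *v v = 0"
    "\<And>w. (\<Sum>i<k. e i *v w) = w"
proof -
  let ?D = "\<lambda>w u. (\<forall>i<k. u i \<in> U i) \<and> (\<forall>i\<ge>k. u i = 0) \<and> w = (\<Sum>i<k. u i)"
  have "\<exists>!u. ?D w u" for w using sum by (simp add: internal_direct_sum_def)
  then obtain c where c: "\<And>w. ?D w (c w)" and uniq: "\<And>w u. ?D w u \<Longrightarrow> u = c w"
    by metis
  have sp: "subspace (U i)" if "i < k" for i using sub[OF that] by (simp add: subrep_def)
  have add: "c (x + y) i = c x i + c y i" for x y i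
  proof -
    have "(\<lambda>i. c x i + c y i) = c (x + y)"
    proof (rule uniq, intro conjI)
      show "x + y = (\<Sum>i<k. c x i + c y i)" using c[of x] c[of y] by (simp add: sum.distrib)
      show "\<forall>i<k. c x i + c y i \<in> U i" using c sp by (metis subspace_add)
      show "\<forall>i\<ge>k. c x i + c y i = 0" using c by (metis add_0)
    qed
    then show ?thesis by metis
  qed
  have scale: "c (r *\<^sub>R x) i = r *\<^sub>R c x i" for x r i
  proof -
    have "(\<lambda>i. r *\<^sub>R c x i) = c (r *\<^sub>R x)"
    proof (rule uniq, intro conjI)
      show "r *\<^sub>R x = (\<Sum>i<k. r *\<^sub>R c x i)" using c[of x] by (simp add: scaleR_sum_right[symmetric])
      show "\<forall>i<k. r *\<^sub>R c x i \<in> U i" using c sp by (metis subspace_scale)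
      show "\<forall>i\<ge>k. r *\<^sub>R c x i = 0" using c by (metis scaleR_zero_right)
    qed
    then show ?thesis by metis
  qed
  have act: "c (A \<sigma> *v x) i = A \<sigma> *v c x i" for x \<sigma> i
  proof -
    have "(\<lambda>i. A \<sigma> *v c x i) = c (A \<sigma> *v x)"
    proof (rule uniq, intro conjI)
      show "A \<sigma> *v x = (\<Sum>i<k. A \<sigma> *v c x i)" using c[of x] by (simp add: matrix_act_sum[symmetric])
      show "\<forall>i<k. A \<sigma> *v c x i \<in> U i" using c sub unfolding subrep_def by metis
      show "\<forall>i\<ge>k. A \<sigma> *v c x i = 0" using c by (metis matrix_vector_mult_0_right)
    qed
    then show ?thesis by metis
  qed
  have single: "c v j = (if j = i then v else 0)" if "i < k" "v \<in> U i" for i j v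
  proof -
    have "(\<lambda>j. if j = i then v else 0) = c v"
      by (rule uniq) (use that sp[THEN subspace_0] in auto)
    from fun_cong[OF this, of j] show ?thesis by simp
  qed
  define e where "e i = matrix (\<lambda>w. c w i)" for i
  have e: "e i *v w = c w i" for i w
  proof -
    have "linear (\<lambda>w. c w i)" by (rule linearI) (simp_all add: add scale)
    then show ?thesis unfolding e_def by (simp add: matrix_works linear_matrix_vector_mul_eq)
  qed
  show ?thesis
  proof
    show "(\<Sum>i<k. e i *v w) = w" for w using c[of w] by (simp add: e)
  qed (use c in \<open>auto simp: e EndW_iff act single\<close>)
qed

section \<open>Transport of subrepresentations and their endomorphisms along intertwiners\<close>

lemma subrep_image:
  assumes "a \<in> EndW A" "subrep A U"
  shows "subrep A ((*v) a ` U)"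
  unfolding subrep_def
proof (intro conjI allI ballI)
  show "subspace ((*v) a ` U)"
    using assms(2) by (auto simp: subrep_def intro: linear_subspace_image)
  fix \<sigma> v assume "v \<in> (*v) a ` U"
  then obtain u where u: "u \<in> U" "v = a *v u" by blast
  then have "A \<sigma> *v v = a *v (A \<sigma> *v u)" using assms(1) by (simp add: EndW_iff)
  then show "A \<sigma> *v v \<in> (*v) a ` U" using u assms(2) by (auto simp: subrep_def)
qed

text \<open>The composite of \<open>a\<close> and \<open>b\<close> is injective on \<open>U\<close>,
  hence bijective there, so the image of \<open>U\<close> under \<open>a\<close> is a direct summand
  of \<open>V\<close> with complement the kernel of \<open>b\<close> in \<open>V\<close>.
  Indecomposability of \<open>V\<close> leaves no room for the complement.\<close>

lemma indecomposable_retract: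
  fixes A :: "'a \<Rightarrow> real^'n^'n"
  assumes U: "subrep A U" "U \<noteq> {0}" and V: "indecomposable A V"
    and a: "a \<in> EndW A" "\<And>u. u \<in> U \<Longrightarrow> a *v u \<in> V"
    and b: "b \<in> EndW A" "\<And>v. v \<in> V \<Longrightarrow> b *v v \<in> U"
    and inj: "\<And>u. u \<in> U \<Longrightarrow> b *v (a *v u) = 0 \<Longrightarrow> u = 0"
  shows "(*v) a ` U = V"
proof -
  have spU: "subspace U" and spV: "subspace V" and subV: "subrep A V"
    using U V by (auto simp: subrep_def indecomposable_def)
  have "(\<lambda>u. b *v (a *v u)) ` U = U"
    by (rule injective_endomorphism_image_eq)
      (use a b inj spU in \<open>auto simp: linear_iff matrix_act\<close>)
  then have onto: "\<exists>u\<in>U. b *v (a *v u) = w" if "w \<in> U" for w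
    using that by (metis (no_types, lifting) imageE)
  define V1 where "V1 = (*v) a ` U"
  define V2 where "V2 = {v \<in> V. b *v v = 0}"
  have 1: "subrep A V1"
    unfolding V1_def by (rule subrep_image[OF a(1) U(1)])
  have 2: "subrep A V2"
    using subV b(1) by (auto simp: subrep_def V2_def subspace_def EndW_iff matrix_act)
  have 3: "V1 \<noteq> {0}"
  proof -
    obtain u where "u \<in> U" "u \<noteq> 0" using U(2) subspace_0[OF spU] by blast
    moreover from this have "a *v u \<noteq> 0" using inj by force
    ultimately show ?thesis unfolding V1_def by blast
  qed
  have 4: "V1 \<inter> V2 = {0}"
    using inj subspace_0[OF spU] subspace_0[OF spV] by (force simp: V1_def V2_def image_iff)
  have 5: "{x + y | x y. x \<in> V1 \<and> y \<in> V2} = V"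
  proof safe
    show "x + y \<in> V" if "x \<in> V1" "y \<in> V2" for x y
      using that a(2) spV by (auto simp: V1_def V2_def intro: subspace_add)
    fix v assume v: "v \<in> V"
    obtain u where u: "u \<in> U" "b *v (a *v u) = b *v v" using onto b(2)[OF v] by blast
    have "v - a *v u \<in> V2" unfolding V2_def
      using u v a(2) spV by (auto simp: matrix_act intro: subspace_diff)
    moreover have "a *v u \<in> V1" using u by (simp add: V1_def)
    moreover have "v = a *v u + (v - a *v u)" by simp
    ultimately show "\<exists>x y. v = x + y \<and> x \<in> V1 \<and> y \<in> V2" by blast
  qed
  have "V2 = {0}"
    using V 1 2 3 4 5 unfolding indecomposable_def by blast
  with 5 show ?thesis unfolding V1_def[symmetric] by simp
qed

lemma EndW_rep_iso:
  assumes "a \<in> EndW A" "(*v) a ` U = V" "subspace U" "\<And>u. u \<in> U \<Longrightarrow> a *v u = 0 \<Longrightarrow> u = 0"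
  shows "rep_iso A U V"
proof -
  have "inj_on ((*v) a) U"
  proof (rule inj_onI)
    fix x y assume xy: "x \<in> U" "y \<in> U" "a *v x = a *v y"
    have "x - y = 0"
      by (rule assms(4)) (simp_all add: xy assms(3) subspace_diff matrix_act)
    then show "x = y" by simp
  qed
  then show ?thesis
    unfolding rep_iso_def bij_betw_def using assms(1,2)
    by (intro exI[of _ "(*v) a"]) (auto simp: EndW_iff)
qed

lemma EndRep_lincomb:
  assumes "subspace U" "f \<in> EndRep A U" "g \<in> EndRep A U"
  shows "(\<lambda>x. f x + c *\<^sub>R g x) \<in> EndRep A U"
proof -
  have "linear (\<lambda>x. f x + c *\<^sub>R g x)"
    using assms by (auto simp: EndRep_def intro: linear_compose_add linear_compose_scale_right)
  moreover have "f x + c *\<^sub>R g x \<in> U" if "x \<in> U" for x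
    using assms that by (intro subspace_add subspace_scale) (auto simp: EndRep_def)
  ultimately show ?thesis
    using assms(2,3) by (auto simp: EndRep_def matrix_act)
qed

text \<open>Elements of \<open>NilEnd A U\<close> are maps of the whole space of which only the
  restriction to \<open>U\<close> counts; this allows passing from one representative to
  another.\<close>

lemma NilEnd_cong:
  assumes "g \<in> NilEnd A U" "f \<in> EndRep A U" "\<And>u. u \<in> U \<Longrightarrow> f u = g u"
  shows "f \<in> NilEnd A U"
proof -
  have U: "f u \<in> U" if "u \<in> U" for u using assms(2) that by (auto simp: EndRep_def)
  have "(f ^^ m) u = (g ^^ m) u \<and> (f ^^ m) u \<in> U" if "u \<in> U" for m u
  proof (induction m)
    case (Suc m)
    then show ?case using U[of "(f ^^ m) u"] assms(3)[of "(f ^^ m) u"] by auto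
  qed (use that in simp)
  then show ?thesis using assms(1,2) by (simp add: NilEnd_def)
qed

lemma EndRep_conj:
  assumes "\<phi> \<in> EndW A" "\<psi> \<in> EndW A" "\<And>v. v \<in> K \<Longrightarrow> \<phi> *v v \<in> U"
    "\<And>u. u \<in> U \<Longrightarrow> \<psi> *v u \<in> K" "f \<in> EndRep A U"
  shows "(\<lambda>x. \<psi> *v f (\<phi> *v x)) \<in> EndRep A K"
proof -
  have f: "linear f" "\<And>u. u \<in> U \<Longrightarrow> f u \<in> U" "\<And>\<sigma> u. u \<in> U \<Longrightarrow> f (A \<sigma> *v u) = A \<sigma> *v f u"
    using assms(5) by (auto simp: EndRep_def)
  have "linear (\<lambda>x. \<psi> *v f (\<phi> *v x))"
    using f(1) by (simp add: linear_iff matrix_act)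
  moreover have "(\<lambda>x. \<psi> *v f (\<phi> *v x)) ` K \<subseteq> K"
    using f assms by auto
  moreover have "\<psi> *v f (\<phi> *v (A \<sigma> *v u)) = A \<sigma> *v (\<psi> *v f (\<phi> *v u))" if "u \<in> K" for \<sigma> u
    using f(3)[OF assms(3)[OF that]] assms(1,2) by (simp add: EndW_iff)
  ultimately show ?thesis unfolding EndRep_def by blast
qed

text \<open>Inner factors \<open>\<phi>\<close>, \<open>\<psi>\<close> cancel on \<open>U\<close>,
  so the powers of the conjugate are on \<open>K\<close> the conjugates of the powers of
  \<open>f\<close>.\<close>

lemma NilEnd_conj:
  assumes "\<phi> \<in> EndW A" "\<psi> \<in> EndW A" "\<And>v. v \<in> K \<Longrightarrow> \<phi> *v v \<in> U"
    "\<And>u. u \<in> U \<Longrightarrow> \<psi> *v u \<in> K" "\<And>u. u \<in> U \<Longrightarrow> \<phi> *v (\<psi> *v u) = u"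
    "\<And>v. v \<in> K \<Longrightarrow> \<psi> *v (\<phi> *v v) = v" "f \<in> NilEnd A U"
  shows "(\<lambda>x. \<psi> *v f (\<phi> *v x)) \<in> NilEnd A K"
proof -
  obtain m where f: "f \<in> EndRep A U" "\<And>u. u \<in> U \<Longrightarrow> (f ^^ m) u = 0"
    using assms(7) by (auto simp: NilEnd_def)
  have fU: "f u \<in> U" if "u \<in> U" for u using f(1) that by (auto simp: EndRep_def)
  have "((\<lambda>x. \<psi> *v f (\<phi> *v x)) ^^ j) v = \<psi> *v (f ^^ j) (\<phi> *v v) \<and> (f ^^ j) (\<phi> *v v) \<in> U"
    if "v \<in> K" for j v
    by (induction j) (use that fU assms(3,5,6) in auto)
  then have "\<forall>v\<in>K. ((\<lambda>x. \<psi> *v f (\<phi> *v x)) ^^ m) v = 0"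
    using f(2) assms(3) by simp
  then show ?thesis
    using EndRep_conj[OF assms(1-4) f(1)] unfolding NilEnd_def by blast
qed

text \<open>The injective intertwiner \<open>\<psi>\<close> would carry a splitting of
  \<open>U\<close> to a splitting of \<open>K\<close>.\<close>

lemma indecomposable_transfer:
  fixes A :: "'a \<Rightarrow> real^'n^'n"
  assumes \<psi>: "\<psi> \<in> EndW A" and im: "(*v) \<psi> ` U = K" and inj: "\<And>u. u \<in> U \<Longrightarrow> \<psi> *v u = 0 \<Longrightarrow> u = 0"
    and U: "subrep A U" and K: "indecomposable A K"
  shows "indecomposable A U"
  unfolding indecomposable_def
proof (intro conjI notI U)
  have sp: "subspace U" using U by (simp add: subrep_def)
  show False if "U = {0}" using that im K by (simp add: indecomposable_def)
  assume "\<exists>V1 V2. subrep A V1 \<and> subrep A V2 \<and> V1 \<noteq> {0} \<and> V2 \<noteq> {0} \<and>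
            V1 \<inter> V2 = {0} \<and> {x + y | x y. x \<in> V1 \<and> y \<in> V2} = U"
  then obtain V1 V2 where V: "subrep A V1" "subrep A V2" "V1 \<noteq> {0}" "V2 \<noteq> {0}"
    "V1 \<inter> V2 = {0}" "{x + y | x y. x \<in> V1 \<and> y \<in> V2} = U"
    by blast
  have z: "0 \<in> V1" "0 \<in> V2" using V(5) by auto
  have "x + 0 \<in> U" if "x \<in> V1" for x using that z V(6) by blast
  moreover have "0 + y \<in> U" if "y \<in> V2" for y using that z V(6) by blast
  ultimately have VU: "V1 \<subseteq> U" "V2 \<subseteq> U" by auto
  have nz: "(*v) \<psi> ` V \<noteq> {0}" if V: "V \<subseteq> U" "V \<noteq> {0}" "0 \<in> V" for V
  proof -
    obtain v where "v \<in> V" "v \<noteq> 0" using V by blast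
    then have "\<psi> *v v \<noteq> 0" using inj V(1) by auto
    then show ?thesis using \<open>v \<in> V\<close> by blast
  qed
  have "(*v) \<psi> ` V1 \<inter> (*v) \<psi> ` V2 = {0}"
  proof
    show "(*v) \<psi> ` V1 \<inter> (*v) \<psi> ` V2 \<subseteq> {0}"
    proof
      fix w assume "w \<in> (*v) \<psi> ` V1 \<inter> (*v) \<psi> ` V2"
      then obtain x y where xy: "x \<in> V1" "y \<in> V2" "w = \<psi> *v x" "w = \<psi> *v y" by blast
      have "x - y = 0"
        by (rule inj) (use xy VU sp in \<open>auto simp: matrix_act intro: subspace_diff\<close>)
      then have "x \<in> V1 \<inter> V2" using xy by simp
      then show "w \<in> {0}" using V(5) xy by simp
    qed
    show "{0} \<subseteq> (*v) \<psi> ` V1 \<inter> (*v) \<psi> ` V2"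
      using z by (auto intro: image_eqI[of _ _ 0])
  qed
  moreover have "{x + y | x y. x \<in> (*v) \<psi> ` V1 \<and> y \<in> (*v) \<psi> ` V2} = K"
  proof -
    have "{x + y | x y. x \<in> (*v) \<psi> ` V1 \<and> y \<in> (*v) \<psi> ` V2}
        = (*v) \<psi> ` {x + y | x y. x \<in> V1 \<and> y \<in> V2}"
    proof (intro subset_antisym subsetI)
      fix w assume "w \<in> {x + y | x y. x \<in> (*v) \<psi> ` V1 \<and> y \<in> (*v) \<psi> ` V2}"
      then obtain x y where "x \<in> V1" "y \<in> V2" "w = \<psi> *v (x + y)"
        by (auto simp: matrix_vector_right_distrib)
      then show "w \<in> (*v) \<psi> ` {x + y | x y. x \<in> V1 \<and> y \<in> V2}" by blast
    next
      fix w assume "w \<in> (*v) \<psi> ` {x + y | x y. x \<in> V1 \<and> y \<in> V2}"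
      then obtain x y where "x \<in> V1" "y \<in> V2" "w = \<psi> *v x + \<psi> *v y"
        by (auto simp: matrix_vector_right_distrib)
      then show "w \<in> {x + y | x y. x \<in> (*v) \<psi> ` V1 \<and> y \<in> (*v) \<psi> ` V2}" by blast
    qed
    then show ?thesis using V(6) im by simp
  qed
  moreover have "(*v) \<psi> ` V1 \<noteq> {0}" "(*v) \<psi> ` V2 \<noteq> {0}"
    using nz VU V(3,4) z by auto
  ultimately have "\<exists>V1 V2. subrep A V1 \<and> subrep A V2 \<and> V1 \<noteq> {0} \<and> V2 \<noteq> {0} \<and>
            V1 \<inter> V2 = {0} \<and> {x + y | x y. x \<in> V1 \<and> y \<in> V2} = K"
    by (intro exI[of _ "(*v) \<psi> ` V1"] exI[of _ "(*v) \<psi> ` V2"] conjI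
        subrep_image[OF \<psi> V(1)] subrep_image[OF \<psi> V(2)])
  then show False using K unfolding indecomposable_def by simp
qed

text \<open>Conjugation by the mutually inverse \<open>\<phi>\<close> and \<open>\<psi>\<close>
  matches endomorphisms with endomorphisms and nilpotent ones with nilpotent ones. Each condition is
  moved to \<open>K\<close>, used there and moved back; \<open>NilEnd_cong\<close> absorbs the
  discrepancy outside \<open>U\<close>.\<close>

lemma abs_indecomposable_transfer:
  fixes A :: "'a \<Rightarrow> real^'n^'n"
  assumes \<phi>: "\<phi> \<in> EndW A" and \<psi>: "\<psi> \<in> EndW A"
    and \<phi>K: "\<And>v. v \<in> K \<Longrightarrow> \<phi> *v v \<in> U" and \<psi>U: "\<And>u. u \<in> U \<Longrightarrow> \<psi> *v u \<in> K"
    and \<phi>\<psi>: "\<And>u. u \<in> U \<Longrightarrow> \<phi> *v (\<psi> *v u) = u" and \<psi>\<phi>: "\<And>v. v \<in> K \<Longrightarrow> \<psi> *v (\<phi> *v v) = v"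
    and U: "subrep A U" and K: "abs_indecomposable A K"
  shows "abs_indecomposable A U"
proof -
  have sp: "subspace U" using U by (simp add: subrep_def)
  let ?c = "\<lambda>f x. \<psi> *v f (\<phi> *v x)" and ?b = "\<lambda>f x. \<phi> *v f (\<psi> *v x)"
  have cE: "?c f \<in> EndRep A K" if "f \<in> EndRep A U" for f
    by (rule EndRep_conj[OF \<phi> \<psi> _ _ that]) (fact \<phi>K \<psi>U)+
  have bE: "?b f \<in> EndRep A U" if "f \<in> EndRep A K" for f
    by (rule EndRep_conj[OF \<psi> \<phi> _ _ that]) (fact \<phi>K \<psi>U)+
  have cN: "?c f \<in> NilEnd A K" if "f \<in> NilEnd A U" for f
    by (rule NilEnd_conj[OF \<phi> \<psi> _ _ _ _ that]) (fact \<phi>K \<psi>U \<phi>\<psi> \<psi>\<phi>)+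
  have bN: "?b f \<in> NilEnd A U" if "f \<in> NilEnd A K" for f
    by (rule NilEnd_conj[OF \<psi> \<phi> _ _ _ _ that]) (fact \<phi>K \<psi>U \<phi>\<psi> \<psi>\<phi>)+
  have KN: "(\<lambda>x. f x + c *\<^sub>R g x) \<in> NilEnd A K" if "f \<in> NilEnd A K" "g \<in> NilEnd A K" for f g c
    using K that unfolding abs_indecomposable_def by simp
  have NE: "f \<in> EndRep A V" if "f \<in> NilEnd A V" for f V using that by (simp add: NilEnd_def)
  have "indecomposable A U"
  proof (rule indecomposable_transfer[OF \<psi> _ _ U])
    show "(*v) \<psi> ` U = K"
    proof
      show "K \<subseteq> (*v) \<psi> ` U"
        using \<psi>\<phi> \<phi>K by (metis image_eqI subsetI)
    qed (use \<psi>U in auto)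
    show "u = 0" if "u \<in> U" "\<psi> *v u = 0" for u
      using \<phi>\<psi>[OF that(1)] that(2) by simp
    show "indecomposable A K" using K by (simp add: abs_indecomposable_def)
  qed
  moreover have "(\<lambda>x. f x + c *\<^sub>R g x) \<in> NilEnd A U" if f: "f \<in> NilEnd A U" and g: "g \<in> NilEnd A U" for f g c
  proof -
    have "(\<lambda>x. ?c f x + c *\<^sub>R ?c g x) \<in> NilEnd A K"
      by (rule KN[OF cN[OF f] cN[OF g]])
    from bN[OF this] show ?thesis
    proof (rule NilEnd_cong)
      show "(\<lambda>x. f x + c *\<^sub>R g x) \<in> EndRep A U"
        by (rule EndRep_lincomb[OF sp NE[OF f] NE[OF g]])
      fix u assume u: "u \<in> U"
      have "f u \<in> U" "g u \<in> U" using u NE[OF f] NE[OF g] by (auto simp: EndRep_def)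
      then show "f u + c *\<^sub>R g u = ?b (\<lambda>x. ?c f x + c *\<^sub>R ?c g x) u"
        using u by (simp add: \<phi>\<psi> matrix_vector_right_distrib matrix_vector_mult_scaleR)
    qed
  qed
  moreover have "\<exists>e\<in>EndRep A U. e \<notin> NilEnd A U \<and>
        (\<forall>f\<in>EndRep A U. \<exists>c::real. (\<lambda>x. f x - c *\<^sub>R e x) \<in> NilEnd A U)"
  proof -
    obtain e where e: "e \<in> EndRep A K" "e \<notin> NilEnd A K"
      "\<And>f. f \<in> EndRep A K \<Longrightarrow> \<exists>c::real. (\<lambda>x. f x - c *\<^sub>R e x) \<in> NilEnd A K"
      using K unfolding abs_indecomposable_def by blast
    have eK: "e v \<in> K" if "v \<in> K" for v using that e(1) by (auto simp: EndRep_def)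
    show ?thesis
    proof (intro bexI[of _ "?b e"] conjI notI ballI)
      assume "?b e \<in> NilEnd A U"
      from cN[OF this] have "e \<in> NilEnd A K"
        by (rule NilEnd_cong[OF _ e(1)]) (simp add: \<psi>\<phi> eK)
      then show False using e(2) by simp
    next
      fix f assume f: "f \<in> EndRep A U"
      obtain c where "(\<lambda>x. ?c f x - c *\<^sub>R e x) \<in> NilEnd A K"
        using e(3)[OF cE[OF f]] by blast
      from bN[OF this] have "(\<lambda>x. f x - c *\<^sub>R ?b e x) \<in> NilEnd A U"
      proof (rule NilEnd_cong)
        show "(\<lambda>x. f x - c *\<^sub>R ?b e x) \<in> EndRep A U"
          using EndRep_lincomb[OF sp f bE[OF e(1)], of "- c"] by simp
        fix u assume u: "u \<in> U"
        have "f u \<in> U" using u f by (auto simp: EndRep_def)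
        then show "f u - c *\<^sub>R ?b e u = ?b (\<lambda>x. ?c f x - c *\<^sub>R e x) u"
          using u by (simp add: \<phi>\<psi> matrix_vector_mult_diff_distrib matrix_vector_mult_scaleR)
      qed
      then show "\<exists>c. (\<lambda>x. f x - c *\<^sub>R ?b e x) \<in> NilEnd A U" by blast
    qed (rule bE[OF e(1)])
  qed
  ultimately show ?thesis unfolding abs_indecomposable_def by blast
qed

section \<open>Sums of pairwise non-isomorphic indecomposables\<close>

text \<open>The decomposition enters through its projections \<open>e i\<close>, which are supplied
  by \<open>direct_sum_projections\<close>. Keeping them as fixed elements of the commutant allows
  endomorphisms to be handled as block matrices.\<close>

locale krull_schmidt_sum =
  fixes A :: "'a \<Rightarrow> real^'n^'n" and U :: "nat \<Rightarrow> (real^'n) set" and k :: nat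
    and e :: "nat \<Rightarrow> real^'n^'n"
  assumes indec: "i < k \<Longrightarrow> indecomposable A (U i)"
    and noniso: "i < k \<Longrightarrow> j < k \<Longrightarrow> i \<noteq> j \<Longrightarrow> \<not> rep_iso A (U i) (U j)"
    and e_EndW: "i < k \<Longrightarrow> e i \<in> EndW A"
    and e_mem: "i < k \<Longrightarrow> e i *v w \<in> U i"
    and e_id: "i < k \<Longrightarrow> v \<in> U i \<Longrightarrow> e i *v v = v"
    and e_orth: "i < k \<Longrightarrow> j < k \<Longrightarrow> i \<noteq> j \<Longrightarrow> v \<in> U j \<Longrightarrow> e i *v v = 0"
    and e_sum: "(\<Sum>i<k. e i *v w) = w"
begin

text \<open>Since \<open>End(U i)\<close> is local, the \<open>x\<close> satisfying the next predicate form the completely prime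
  ideal of all \<open>x \<in> End(W)\<close> whose \<open>i\<close>-th diagonal block is nilpotent.\<close>

definition singular_at :: "nat \<Rightarrow> real^'n^'n \<Rightarrow> bool" where
  "singular_at i x \<longleftrightarrow> (\<exists>v\<in>U i. v \<noteq> 0 \<and> e i *v (x *v v) = 0)"

lemma subspace_U: "i < k \<Longrightarrow> subspace (U i)"
  and subrep_U: "i < k \<Longrightarrow> subrep A (U i)"
  and U_nontrivial: "i < k \<Longrightarrow> \<exists>v\<in>U i. v \<noteq> 0"
  using indec[of i] by (auto simp: indecomposable_def subrep_def dest: subspace_0)

text \<open>This is the locality of \<open>End(U i)\<close>. The Fitting projection of the block
  splits \<open>U i\<close> into a part in the generalized kernel and a complement. Singularity
  makes the first part nonzero, so by indecomposability it is all of \<open>U i\<close>.\<close>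

lemma block_nilpotent:
  assumes i: "i < k" and x: "x \<in> EndW A" and sing: "singular_at i x"
  obtains m where "\<And>v. v \<in> U i \<Longrightarrow> ((\<lambda>v. e i *v (x *v v)) ^^ m) v = 0"
proof -
  define X where "X = e i ** x ** e i"
  have X: "X *v v = e i *v (x *v v)" if "v \<in> U i" for v
    using that i by (simp add: X_def matrix_act e_id)
  have ee: "e i ** e i = e i" using i by (simp add: matrix_eq matrix_act e_id e_mem)
  have XE: "X \<in> EndW A" unfolding X_def by (intro EndW_mult e_EndW i x)
  obtain f where comm: "\<And>B. B ** X = X ** B \<Longrightarrow> B ** f = f ** B"
    and fK: "\<And>v. f *v v \<in> gen_ker X" and fid: "\<And>v. v \<in> gen_ker X \<Longrightarrow> f *v v = v"
    using fitting_projection[of X] by blast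
  have fE: "f \<in> EndW A"
    unfolding EndW_def using comm XE by (simp add: EndW_def)
  \<comment> \<open>\<open>X\<close> is compressed by \<open>e i\<close> on both sides so that it
    commutes with \<open>e i\<close>. Hence \<open>f\<close> commutes with \<open>e i\<close> too
    and restricts to \<open>U i\<close>.\<close>
  have "e i ** X = X ** e i"
    unfolding X_def by (metis ee matrix_mul_assoc)
  from comm[OF this] have ef: "e i *v (f *v v) = f *v (e i *v v)" for v
    by (metis matrix_vector_mul_assoc)
  have fU: "f *v v \<in> U i" if "v \<in> U i" for v
    using ef[of v] e_mem[OF i, of "f *v v"] e_id[OF i that] by simp
  have ff: "f *v (f *v v) = f *v v" for v by (rule fid[OF fK])
  define V1 where "V1 = {v \<in> U i. f *v v = v}"
  define V2 where "V2 = {v \<in> U i. f *v v = 0}"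
  have V1: "subrep A V1"
    unfolding subrep_def
  proof (intro conjI allI ballI)
    show "subspace V1" using subspace_U[OF i]
      by (auto simp: V1_def subspace_def matrix_act)
    show "A \<sigma> *v v \<in> V1" if "v \<in> V1" for \<sigma> v
      using that subrep_U[OF i] fE by (auto simp: V1_def subrep_def EndW_iff)
  qed
  have V2: "subrep A V2"
    unfolding subrep_def
  proof (intro conjI allI ballI)
    show "subspace V2" using subspace_U[OF i]
      by (auto simp: V2_def subspace_def matrix_act)
    show "A \<sigma> *v v \<in> V2" if "v \<in> V2" for \<sigma> v
      using that subrep_U[OF i] fE by (auto simp: V2_def subrep_def EndW_iff)
  qed
  have V12: "V1 \<inter> V2 = {0}"
    using subspace_0[OF subspace_U[OF i]] by (auto simp: V1_def V2_def)
  have sum: "{x + y | x y. x \<in> V1 \<and> y \<in> V2} = U i"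
  proof (intro subset_antisym subsetI)
    fix v assume v: "v \<in> U i"
    have "f *v v \<in> V1" using fU[OF v] by (simp add: V1_def ff)
    moreover have "v - f *v v \<in> V2"
      using subspace_diff[OF subspace_U[OF i] v fU[OF v]] by (simp add: V2_def matrix_act ff)
    moreover have "v = f *v v + (v - f *v v)" by simp
    ultimately show "v \<in> {x + y | x y. x \<in> V1 \<and> y \<in> V2}" by blast
  next
    fix v assume "v \<in> {x + y | x y. x \<in> V1 \<and> y \<in> V2}"
    then show "v \<in> U i"
      using subspace_add[OF subspace_U[OF i]] by (auto simp: V1_def V2_def)
  qed
  have "V1 \<noteq> {0}"
  proof -
    obtain v where v: "v \<in> U i" "v \<noteq> 0" "e i *v (x *v v) = 0"
      using sing by (auto simp: singular_at_def)
    then have "((*v) X ^^ 1) v = 0" by (simp add: X)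
    then have "v \<in> gen_ker X" unfolding gen_ker_def by blast
    then have "v \<in> V1" using v fid by (simp add: V1_def)
    then show ?thesis using v by blast
  qed
  then have V20: "V2 = {0}"
    using indec[OF i] V1 V2 V12 sum unfolding indecomposable_def by blast
  have UK: "v \<in> gen_ker X" if v: "v \<in> U i" for v
  proof -
    have "v - f *v v \<in> V2"
      using subspace_diff[OF subspace_U[OF i] v fU[OF v]] by (simp add: V2_def matrix_act ff)
    then have "v = f *v v" using V20 by simp
    then show ?thesis using fK[of v] by simp
  qed
  obtain m where m: "\<And>v. v \<in> gen_ker X \<Longrightarrow> ((*v) X ^^ m) v = 0"
    using gen_ker_exponent by blast
  show ?thesis
  proof
    fix v assume v: "v \<in> U i"
    have "((*v) X ^^ j) v = ((\<lambda>v. e i *v (x *v v)) ^^ j) v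
        \<and> ((\<lambda>v. e i *v (x *v v)) ^^ j) v \<in> U i" for j
      by (induction j) (use v i in \<open>auto simp: X e_mem\<close>)
    then show "((\<lambda>v. e i *v (x *v v)) ^^ m) v = 0"
      using m[OF UK[OF v]] by metis
  qed
qed

text \<open>A nilpotent map has no nonzero fixed vector. Locality is used below mostly in this
  form.\<close>

lemma singular_at_fixed_imp_0:
  assumes i: "i < k" and x: "x \<in> EndW A" "singular_at i x" and v: "v \<in> U i" "e i *v (x *v v) = v"
  shows "v = 0"
proof -
  obtain m where m: "((\<lambda>v. e i *v (x *v v)) ^^ m) v = 0"
    using block_nilpotent[OF i x] v(1) by metis
  have "((\<lambda>v. e i *v (x *v v)) ^^ m) v = v"
    by (induction m) (use v(2) in auto)
  then show ?thesis using m by simp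
qed

text \<open>Completing the block by the identity on the other summands gives an injective element
  \<open>X\<close> of the commutant; the inverse of \<open>X\<close>, followed by
  \<open>e i\<close>, inverts the block.\<close>

lemma nonsingular_at_inverse:
  assumes i: "i < k" and x: "x \<in> EndW A" "\<not> singular_at i x"
  obtains y where "y \<in> EndW A" "\<And>w. y *v w \<in> U i"
    "\<And>v. v \<in> U i \<Longrightarrow> y *v (e i *v (x *v v)) = v"
    "\<And>v. v \<in> U i \<Longrightarrow> e i *v (x *v (y *v v)) = v"
proof -
  define X where "X = e i ** x ** e i + (mat 1 - e i)"
  have X: "X *v w = e i *v (x *v (e i *v w)) + (w - e i *v w)" for w
    by (simp add: X_def matrix_act)
  have eX: "e i *v (X *v w) = e i *v (x *v (e i *v w))" for w
    using i by (simp add: X matrix_act e_id e_mem)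
  have XE: "X \<in> EndW A"
    unfolding X_def by (intro subspace_add subspace_diff subspace_EndW EndW_mult e_EndW EndW_mat1 i x)
  have inj: "w = 0" if w: "X *v w = 0" for w
  proof -
    from w
    have "e i *v (x *v (e i *v w)) = 0" using eX[of w] by simp
    then have "e i *v w = 0"
      using x(2) e_mem[OF i, of w] by (auto simp: singular_at_def)
    then show ?thesis using w by (simp add: X)
  qed
  obtain Y where Y: "Y \<in> EndW A" "\<And>v. X *v (Y *v v) = v" "\<And>v. Y *v (X *v v) = v"
    using EndW_injective_imp_inverse[OF XE inj] by metis
  show ?thesis
  proof
    show "e i ** Y \<in> EndW A" by (intro EndW_mult e_EndW i Y)
    show "(e i ** Y) *v w \<in> U i" for w using i by (simp add: matrix_act e_mem)
    fix v assume v: "v \<in> U i"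
    have "X *v v = e i *v (x *v v)" using e_id[OF i v] by (simp add: X)
    then have "Y *v (e i *v (x *v v)) = v" using Y(3)[of v] by simp
    then show "(e i ** Y) *v (e i *v (x *v v)) = v"
      using e_id[OF i v] by (simp add: matrix_act)
    show "e i *v (x *v ((e i ** Y) *v v)) = v"
      using eX[of "Y *v v"] Y(2)[of v] e_id[OF i v] by (simp add: matrix_act)
  qed
qed

section \<open>Sums and products of singular elements\<close>

lemma singular_at_0: "i < k \<Longrightarrow> singular_at i 0"
  using U_nontrivial by (auto simp: singular_at_def)

lemma not_singular_at_1: "i < k \<Longrightarrow> \<not> singular_at i (mat 1)"
  by (auto simp: singular_at_def e_id)

lemma singular_at_scaleR: "singular_at i x \<Longrightarrow> singular_at i (c *\<^sub>R x)"
  by (force simp: singular_at_def scaleR_matrix_act matrix_act)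

text \<open>The \<open>e i\<close> in the middle isolates one term of block multiplication: the
  \<open>i\<close>-th diagonal block of this product is the product of the diagonal blocks of
  \<open>x\<close> and \<open>y\<close>.\<close>

lemma singular_at_mult_left:
  assumes "singular_at i y"
  shows "singular_at i (x ** e i ** y)"
  using assms by (force simp: singular_at_def matrix_act)

text \<open>If the block of \<open>y\<close> is invertible, its inverse pulls a kernel vector of the
  block of \<open>x\<close> back to one of the product.\<close>

lemma singular_at_mult_right:
  assumes i: "i < k" and x: "singular_at i x" and y: "y \<in> EndW A"
  shows "singular_at i (x ** e i ** y)"
proof (cases "singular_at i y")
  case False
  obtain z where z: "\<And>w. z *v w \<in> U i" "\<And>v. v \<in> U i \<Longrightarrow> e i *v (y *v (z *v v)) = v"
    using nonsingular_at_inverse[OF i y False] by metis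
  obtain v where v: "v \<in> U i" "v \<noteq> 0" "e i *v (x *v v) = 0"
    using x by (auto simp: singular_at_def)
  have "z *v v \<noteq> 0" using z(2)[OF v(1)] v(2) by auto
  moreover have "e i *v ((x ** e i ** y) *v (z *v v)) = 0"
    using z(2)[OF v(1)] v(3) by (simp add: matrix_act)
  ultimately show ?thesis using z(1) unfolding singular_at_def by blast
qed (rule singular_at_mult_left)

text \<open>The usual argument for local rings: if \<open>z\<close> inverted the block of
  \<open>x + y\<close>, a kernel vector of the block of \<open>y\<close> would be fixed by
  \<open>z\<close> times the block of \<open>x\<close>, which is singular and hence
  nilpotent.\<close>

lemma singular_at_add:
  assumes i: "i < k" and x: "x \<in> EndW A" "singular_at i x" and y: "y \<in> EndW A" "singular_at i y"
  shows "singular_at i (x + y)"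
proof (rule ccontr)
  assume "\<not> singular_at i (x + y)"
  then obtain z where z: "z \<in> EndW A" "\<And>w. z *v w \<in> U i"
    "\<And>v. v \<in> U i \<Longrightarrow> z *v (e i *v ((x + y) *v v)) = v"
    using nonsingular_at_inverse[OF i subspace_add[OF subspace_EndW x(1) y(1)]] by metis
  obtain v where v: "v \<in> U i" "v \<noteq> 0" "e i *v (y *v v) = 0"
    using y(2) by (auto simp: singular_at_def)
  have "v = 0"
  proof (rule singular_at_fixed_imp_0[OF i _ _ v(1)])
    show "z ** e i ** x \<in> EndW A" by (intro EndW_mult e_EndW i x z)
    show "singular_at i (z ** e i ** x)" by (rule singular_at_mult_left[OF x(2)])
    show "e i *v ((z ** e i ** x) *v v) = v"
      using z(3)[OF v(1)] v(3) e_id[OF i z(2)] e_id[OF i v(1)] by (simp add: matrix_act)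
  qed
  then show False using v by simp
qed

lemma subspace_singular_at: "i < k \<Longrightarrow> subspace {x \<in> EndW A. singular_at i x}"
  unfolding subspace_def
  using singular_at_0 singular_at_add singular_at_scaleR subspace_EndW[of A]
  by (auto simp: subspace_def)

text \<open>Here non-isomorphism enters. If the passage from \<open>U i\<close> through
  \<open>U j\<close> back to \<open>U i\<close> were injective,
  \<open>indecomposable_retract\<close> would make its first half an isomorphism of
  \<open>U i\<close> with \<open>U j\<close>.\<close>

lemma singular_at_mult_other:
  assumes i: "i < k" and j: "j < k" and ij: "i \<noteq> j" and x: "x \<in> EndW A" and y: "y \<in> EndW A"
  shows "singular_at i (x ** e j ** y)"
proof (rule ccontr)
  assume ns: "\<not> singular_at i (x ** e j ** y)"
  have inj: "v = 0" if "v \<in> U i" "(e i ** x) *v ((e j ** y) *v v) = 0" for v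
    using that ns by (auto simp: singular_at_def matrix_act)
  have a: "e j ** y \<in> EndW A" and b: "e i ** x \<in> EndW A"
    by (intro EndW_mult e_EndW i j x y)+
  have "(*v) (e j ** y) ` U i = U j"
    by (rule indecomposable_retract[OF subrep_U[OF i] _ indec[OF j] a _ b _ inj])
      (use U_nontrivial[OF i] i j in \<open>auto simp: matrix_act e_mem\<close>)
  then have "rep_iso A (U i) (U j)"
    by (rule EndW_rep_iso[OF a _ subspace_U[OF i]]) (use inj in auto)
  then show False using noniso i j ij by blast
qed

lemma mult_eq_sum: "x ** y = (\<Sum>j<k. x ** e j ** y)"
  by (simp add: matrix_eq sum_matrix_act matrix_act matrix_act_sum[symmetric] e_sum)

lemma singular_at_sum:
  assumes "i < k" "\<And>j. j \<in> J \<Longrightarrow> x j \<in> EndW A \<and> singular_at i (x j)"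
  shows "singular_at i (\<Sum>j\<in>J. x j)"
  using subspace_sum[OF subspace_singular_at[OF assms(1)], of J x] assms(2) by auto

text \<open>Inserting the sum of all \<open>e j\<close> between \<open>x\<close> and
  \<open>y\<close>, the terms with \<open>j \<noteq> i\<close> are singular. Modulo singular
  elements only the product of the two \<open>i\<close>-th diagonal blocks remains, and it is
  injective exactly when both are.\<close>

lemma singular_at_mult:
  assumes i: "i < k" and x: "x \<in> EndW A" and y: "y \<in> EndW A"
  shows "singular_at i (x ** y) \<longleftrightarrow> singular_at i x \<or> singular_at i y"
proof
  assume *: "singular_at i x \<or> singular_at i y"
  have "singular_at i (x ** e j ** y)" if "j < k" for j
    using singular_at_mult_left singular_at_mult_right[OF i _ y] singular_at_mult_other[OF i that _ x y] *
    by (cases "j = i") auto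
  then show "singular_at i (x ** y)"
    unfolding mult_eq_sum[of x y]
    by (intro singular_at_sum i) (auto intro!: EndW_mult x y e_EndW)
next
  assume *: "singular_at i (x ** y)"
  have "x ** e i ** y = x ** y + (- 1) *\<^sub>R (\<Sum>j\<in>{..<k} - {i}. x ** e j ** y)"
    using i by (simp add: mult_eq_sum[of x y] sum.remove[of "{..<k}" i])
  moreover have "(\<Sum>j\<in>{..<k} - {i}. x ** e j ** y) \<in> EndW A"
    by (intro subspace_sum[OF subspace_EndW]) (auto intro!: EndW_mult x y e_EndW)
  moreover have "singular_at i (\<Sum>j\<in>{..<k} - {i}. x ** e j ** y)"
    by (intro singular_at_sum i) (auto intro!: EndW_mult x y e_EndW singular_at_mult_other i)
  ultimately have "singular_at i (x ** e i ** y)"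
    using singular_at_add[OF i EndW_mult[OF x y] *] singular_at_scaleR subspace_scale[OF subspace_EndW]
    by metis
  then obtain v where "v \<in> U i" "v \<noteq> 0" "e i *v (x *v (e i *v (y *v v))) = 0"
    by (auto simp: singular_at_def matrix_act)
  then show "singular_at i x \<or> singular_at i y"
    using e_mem[OF i] unfolding singular_at_def by metis
qed

text \<open>Elements that are singular everywhere form the Jacobson radical: \<open>1 - x\<close> is inverted one
  column block at a time.\<close>

lemma singular_everywhere_no_fixed_vector:
  assumes x: "x \<in> EndW A" "\<And>i. i < k \<Longrightarrow> singular_at i x" and v: "x *v v = v"
  shows "v = 0"
proof -
  \<comment> \<open>The induction is on the number \<open>m\<close> of components of
    \<open>v\<close> on which the right-hand side depends; \<open>x\<close> must be allowed to
    change. The claim is the case \<open>m = k\<close>.\<close>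
  have "v = 0" if "m \<le> k" "x \<in> EndW A" "\<And>i. i < k \<Longrightarrow> singular_at i x"
      "x *v (\<Sum>i<m. e i *v v) = v" for m x v
    using that
  proof (induction m arbitrary: x v)
    case 0
    then show ?case by simp
  next
    case (Suc m)
    note x = Suc.prems(2,3)
    have m: "m < k" using Suc.prems(1) by simp
    have X: "mat 1 - x ** e m \<in> EndW A"
      by (intro subspace_diff subspace_EndW EndW_mat1 EndW_mult e_EndW m x)
    have inj: "w = 0" if "(mat 1 - x ** e m) *v w = 0" for w
    proof -
      from that have w: "w = x *v (e m *v w)" by (simp add: matrix_act)
      then have "e m *v (x *v (e m *v w)) = e m *v w" by metis
      then have "e m *v w = 0"
        by (rule singular_at_fixed_imp_0[OF m x(1) x(2)[OF m] e_mem[OF m]])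
      then show ?thesis using w by simp
    qed
    obtain u where u: "u \<in> EndW A" "\<And>w. u *v ((mat 1 - x ** e m) *v w) = w"
      using EndW_injective_imp_inverse[OF X inj] by metis
    have "(mat 1 - x ** e m) *v v = x *v (\<Sum>i<m. e i *v v)"
      using Suc.prems(4) by (simp add: matrix_act algebra_simps)
    \<comment> \<open>Solving for \<open>v\<close> removes component \<open>m\<close> at the price
      of replacing \<open>x\<close> by \<open>u ** x\<close>, which is still singular everywhere by
      the ideal property.\<close>
    then have "(u ** x) *v (\<Sum>i<m. e i *v v) = v"
      using u(2)[of v] by (simp add: matrix_act)
    then show ?case
      by (intro Suc.IH[of "u ** x"]) (use Suc.prems(1) u x in \<open>auto simp: EndW_mult singular_at_mult\<close>)
  qed
  from this[OF order_refl x] show ?thesis using v by (simp add: e_sum)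
qed

section \<open>Invertibility and generalized kernels read off from the singular blocks\<close>

lemma singular_at_nilpotent:
  assumes i: "i < k" and x: "x \<in> EndW A" and nil: "\<And>v. ((*v) x ^^ m) v = 0"
  shows "singular_at i x"
proof (rule ccontr)
  assume ns: "\<not> singular_at i x"
  \<comment> \<open>These are the powers of \<open>x\<close>. By primeness none of them is singular,
    whereas the power \<open>m\<close> is zero.\<close>
  define p where "p j = (((**) x) ^^ j) (mat 1)" for j
  have p: "p j \<in> EndW A \<and> \<not> singular_at i (p j)" for j
    by (induction j)
      (use i x ns in \<open>auto simp: p_def EndW_mat1 EndW_mult not_singular_at_1 singular_at_mult\<close>)
  have "p j *v v = ((*v) x ^^ j) v" for j v
    by (induction j) (auto simp: p_def matrix_act)
  then have "p m = 0" using nil by (simp add: matrix_eq)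
  then show False using p[of m] singular_at_0[OF i] by simp
qed

text \<open>\<open>L ** f\<close> is nilpotent, so by primeness \<open>L\<close> or \<open>f\<close>
  is singular at \<open>i\<close>. They are not both singular, because \<open>L + f\<close> is
  invertible.\<close>

lemma fitting_idempotent:
  assumes L: "L \<in> EndW A"
  obtains f where "f \<in> EndW A" "\<And>v. f *v v \<in> gen_ker L" "\<And>v. v \<in> gen_ker L \<Longrightarrow> f *v v = v"
    "\<And>i. i < k \<Longrightarrow> singular_at i f \<longleftrightarrow> \<not> singular_at i L"
proof -
  obtain f where comm: "\<And>B. B ** L = L ** B \<Longrightarrow> B ** f = f ** B"
    and fK: "\<And>v. f *v v \<in> gen_ker L" and fid: "\<And>v. v \<in> gen_ker L \<Longrightarrow> f *v v = v"
    using fitting_projection[of L] by blast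
  have fE: "f \<in> EndW A"
    unfolding EndW_def using comm L by (simp add: EndW_def)
  have Lf: "L *v (f *v v) = f *v (L *v v)" for v
    using comm[of L] by (metis matrix_vector_mul_assoc)
  have ff: "f *v (f *v v) = f *v v" for v by (rule fid[OF fK])
  obtain m where m: "\<And>v. v \<in> gen_ker L \<Longrightarrow> ((*v) L ^^ m) v = 0"
    using gen_ker_exponent by blast
  have LfE: "L ** f \<in> EndW A" and sE: "L + f \<in> EndW A"
    by (intro EndW_mult L fE subspace_add[OF subspace_EndW])+
  have fpow: "((*v) L ^^ j) (f *v v) = f *v (((*v) L ^^ j) v)" for j v
    by (induction j) (simp_all add: Lf)
  \<comment> \<open>The exponent is a successor because the zeroth power of \<open>L ** f\<close> is
    the identity rather than \<open>f\<close>.\<close>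
  have "((*v) (L ** f) ^^ Suc j) v = f *v (((*v) L ^^ Suc j) v)" for j v
    by (induction j) (simp_all add: matrix_act Lf ff)
  then have nil: "((*v) (L ** f) ^^ Suc m) v = 0" for v
    using m[OF fK[of v]] fpow[of m v] Lf by (metis funpow.simps(2) matrix_vector_mult_0_right o_apply)
  \<comment> \<open>On the generalized kernel \<open>L + f\<close> is a nilpotent map plus the
    identity, so the part \<open>u\<close> of \<open>w\<close> in it vanishes. What remains is
    killed by \<open>L\<close> and therefore lies in the generalized kernel as well.\<close>
  have s0: "w = 0" if w: "(L + f) *v w = 0" for w
  proof -
    define u where "u = f *v w"
    have "L *v u + u = f *v ((L + f) *v w)" by (simp add: u_def matrix_act Lf ff)
    then have Lu: "L *v u = - u" using w by (simp add: eq_neg_iff_add_eq_0)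
    have "((*v) L ^^ j) u = (- 1) ^ j *\<^sub>R u" for j
      by (induction j) (simp_all add: matrix_act Lu)
    then have "u = 0" using m[OF fK[of w]] by (simp add: u_def)
    then have "L *v w = 0" using w by (simp add: matrix_act u_def)
    then have "((*v) L ^^ 1) w = 0" by simp
    then have "w \<in> gen_ker L" unfolding gen_ker_def by blast
    then show ?thesis using fid \<open>u = 0\<close> by (simp add: u_def)
  qed
  show ?thesis
  proof (rule that[OF fE fK fid])
    fix i assume i: "i < k"
    have "singular_at i (L ** f)" by (rule singular_at_nilpotent[OF i LfE nil])
    then have "singular_at i L \<or> singular_at i f" using singular_at_mult[OF i L fE] by simp
    moreover have "\<not> (singular_at i L \<and> singular_at i f)"
    proof
      assume "singular_at i L \<and> singular_at i f"
      then have s: "singular_at i (L + f)" using singular_at_add[OF i L _ fE] by simp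
      obtain Y where Y: "Y \<in> EndW A" "\<And>v. Y *v ((L + f) *v v) = v"
        using EndW_injective_imp_inverse[OF sE s0] by metis
      have "Y ** (L + f) = mat 1"
        using Y(2) by (simp add: matrix_eq matrix_vector_mul_assoc)
      then show False
        using singular_at_mult[OF i Y(1) sE] s not_singular_at_1[OF i] by simp
    qed
    ultimately show "singular_at i f \<longleftrightarrow> \<not> singular_at i L" by blast
  qed
qed

text \<open>An inverse would make the identity singular wherever \<open>L\<close> is. Conversely, if
  \<open>L\<close> is singular nowhere, the Fitting projection is singular everywhere and so cannot
  fix a nonzero kernel vector of \<open>L\<close>.\<close>

lemma invertible_iff:
  assumes L: "L \<in> EndW A"
  shows "invertible L \<longleftrightarrow> (\<forall>i<k. \<not> singular_at i L)"
proof
  assume "invertible L"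
  then obtain M where M: "L ** M = mat 1" "M ** L = mat 1" by (auto simp: invertible_def)
  have "M \<in> EndW A" by (rule EndW_inverse[OF L M])
  then show "\<forall>i<k. \<not> singular_at i L"
    using singular_at_mult[OF _ L, of _ M] M(1) not_singular_at_1 by metis
next
  assume ns: "\<forall>i<k. \<not> singular_at i L"
  obtain f where f: "f \<in> EndW A" "\<And>v. v \<in> gen_ker L \<Longrightarrow> f *v v = v"
    "\<And>i. i < k \<Longrightarrow> singular_at i f \<longleftrightarrow> \<not> singular_at i L"
    using fitting_idempotent[OF L] by metis
  have "v = 0" if "L *v v = 0" for v
  proof (rule singular_everywhere_no_fixed_vector[OF f(1)])
    have "((*v) L ^^ 1) v = 0" using that by simp
    then have "v \<in> gen_ker L" unfolding gen_ker_def by blast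
    then show "f *v v = v" by (rule f(2))
  qed (use f(3) ns in blast)
  then show "invertible L"
    using matrix_left_invertible_ker matrix_left_right_inverse unfolding invertible_def by metis
qed

text \<open>The Fitting projection \<open>f\<close> is nonsingular exactly at the indices where
  \<open>L\<close> is singular, so it embeds each such \<open>U i\<close> into the generalized
  kernel. Both directions show that this embedding is onto for a single index \<open>i\<close> and
  then transport absolute indecomposability.\<close>

lemma abs_indecomposable_gen_ker_iff:
  assumes L: "L \<in> EndW A"
  shows "abs_indecomposable A (gen_ker L) \<longleftrightarrow>
    (\<exists>i<k. singular_at i L \<and> abs_indecomposable A (U i) \<and> (\<forall>j<k. singular_at j L \<longrightarrow> j = i))"
proof -
  let ?K = "gen_ker L"
  obtain f where fE: "f \<in> EndW A" and fK: "\<And>v. f *v v \<in> ?K" and fid: "\<And>v. v \<in> ?K \<Longrightarrow> f *v v = v"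
    and sf: "\<And>i. i < k \<Longrightarrow> singular_at i f \<longleftrightarrow> \<not> singular_at i L"
    using fitting_idempotent[OF L] by metis
  have K: "subrep A ?K"
  proof -
    have "subrep A ((*v) f ` UNIV)"
      by (rule subrep_image[OF fE]) (simp add: subrep_def)
    moreover have "(*v) f ` UNIV = ?K" using fK fid by (auto simp: image_iff) metis
    ultimately show ?thesis by simp
  qed
  \<comment> \<open>\<open>\<phi>\<close> inverts the \<open>i\<close>-th block of \<open>f\<close>.
    Its factorization through \<open>e i\<close> is recorded for the later use of
    \<open>singular_at_mult_other\<close>.\<close>
  have inv: "\<exists>\<phi>. \<phi> \<in> EndW A \<and> (\<forall>w. \<phi> *v w \<in> U i) \<and> (\<forall>u\<in>U i. \<phi> *v (f *v u) = u)
      \<and> (\<forall>w. e i *v (f *v (\<phi> *v w)) = e i *v w) \<and> (\<exists>y\<in>EndW A. \<phi> = y ** e i)"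
    if i: "i < k" and s: "singular_at i L" for i
  proof -
    obtain y where y: "y \<in> EndW A" "\<And>w. y *v w \<in> U i"
      "\<And>v. v \<in> U i \<Longrightarrow> y *v (e i *v (f *v v)) = v"
      "\<And>v. v \<in> U i \<Longrightarrow> e i *v (f *v (y *v v)) = v"
      using nonsingular_at_inverse[OF i fE] sf[OF i] s by metis
    show ?thesis
      by (rule exI[of _ "y ** e i"])
        (use y e_mem[OF i] e_EndW[OF i] in \<open>auto simp: matrix_act EndW_mult\<close>)
  qed
  have transfer: "abs_indecomposable A ?K \<longleftrightarrow> abs_indecomposable A (U i)"
    if i: "i < k" and s: "singular_at i L" and im: "(*v) f ` U i = ?K" for i
  proof -
    obtain \<phi> where \<phi>: "\<phi> \<in> EndW A" "\<And>w. \<phi> *v w \<in> U i" "\<And>u. u \<in> U i \<Longrightarrow> \<phi> *v (f *v u) = u"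
      using inv[OF i s] by metis
    have f\<phi>: "f *v (\<phi> *v v) = v" if "v \<in> ?K" for v
      using that im \<phi>(3) by (metis imageE)
    show ?thesis
    proof
      assume "abs_indecomposable A ?K"
      then show "abs_indecomposable A (U i)"
        by (rule abs_indecomposable_transfer[OF \<phi>(1) fE _ _ _ _ subrep_U[OF i], rotated -1])
          (use \<phi> f\<phi> fK in auto)
    next
      assume "abs_indecomposable A (U i)"
      then show "abs_indecomposable A ?K"
        by (rule abs_indecomposable_transfer[OF fE \<phi>(1) _ _ _ _ K, rotated -1])
          (use \<phi> f\<phi> fK in auto)
    qed
  qed
  show ?thesis
  proof
    assume abs: "abs_indecomposable A ?K"
    then have indK: "indecomposable A ?K" by (simp add: abs_indecomposable_def)
    have "\<exists>i<k. singular_at i L"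
    proof (rule ccontr)
      assume "\<not> ?thesis"
      then have "v = 0" if "v \<in> ?K" for v
        by (intro singular_everywhere_no_fixed_vector[OF fE _ fid[OF that]]) (use sf in blast)
      then have "?K = {0}" using K subspace_0 by (auto simp: subrep_def)
      then show False using indK by (simp add: indecomposable_def)
    qed
    then obtain i where i: "i < k" "singular_at i L" by blast
    have im: "(*v) f ` U i = ?K"
    proof (rule indecomposable_retract[OF subrep_U[OF i(1)] _ indK fE _ e_EndW[OF i(1)]])
      show "U i \<noteq> {0}" using U_nontrivial[OF i(1)] by blast
      show "u = 0" if "u \<in> U i" "e i *v (f *v u) = 0" for u
        using sf[OF i(1)] i(2) that by (auto simp: singular_at_def)
    qed (use fK e_mem[OF i(1)] in auto)
    obtain \<phi> y where \<phi>: "\<And>w. \<phi> *v w \<in> U i" "\<And>u. u \<in> U i \<Longrightarrow> \<phi> *v (f *v u) = u"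
      and y: "y \<in> EndW A" "\<phi> = y ** e i"
      using inv[OF i] by metis
    have "j = i" if j: "j < k" "singular_at j L" for j
    proof (rule ccontr)
      \<comment> \<open>Since \<open>f\<close> maps \<open>U i\<close> onto the generalized kernel,
        it factors through \<open>U i\<close>; this makes it singular at every other index
        \<open>j\<close>, against the singularity of \<open>L\<close> there.\<close>
      assume "j \<noteq> i"
      then have "singular_at j ((f ** y) ** e i ** f)"
        using singular_at_mult_other[OF j(1) i(1)] fE y(1) by (simp add: EndW_mult)
      moreover have "f *v (\<phi> *v (f *v w)) = f *v w" for w
        using fK[of w] im \<phi>(2) by (metis imageE)
      then have "(f ** y) ** e i ** f = f"
        by (simp add: matrix_eq matrix_act y(2))
      ultimately show False using sf[OF j(1)] j(2) by simp
    qed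
    then show "\<exists>i<k. singular_at i L \<and> abs_indecomposable A (U i) \<and> (\<forall>j<k. singular_at j L \<longrightarrow> j = i)"
      using transfer[OF i im] abs i by blast
  next
    assume "\<exists>i<k. singular_at i L \<and> abs_indecomposable A (U i) \<and> (\<forall>j<k. singular_at j L \<longrightarrow> j = i)"
    then obtain i where i: "i < k" "singular_at i L" and abs: "abs_indecomposable A (U i)"
      and only: "\<And>j. j < k \<Longrightarrow> singular_at j L \<Longrightarrow> j = i" by blast
    obtain \<phi> where \<phi>: "\<And>w. \<phi> *v w \<in> U i" "\<And>w. e i *v (f *v (\<phi> *v w)) = e i *v w"
      using inv[OF i] by metis
    have "f *v (\<phi> *v v) = v" if v: "v \<in> ?K" for v
    proof -
      \<comment> \<open>The defect \<open>d\<close> is fixed by \<open>f ** (mat 1 - e i)\<close>.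
        This product is singular at \<open>i\<close> because of its second factor and at all other
        indices because of \<open>f\<close>, so \<open>d\<close> vanishes.\<close>
      define d where "d = f *v (\<phi> *v v) - v"
      have "d \<in> ?K" using K fK v unfolding d_def subrep_def by (metis subspace_diff)
      then have "f *v d = d" by (rule fid)
      moreover have ed: "e i *v d = 0" by (simp add: d_def matrix_act \<phi>(2))
      ultimately have fixed: "(f ** (mat 1 - e i)) *v d = d" by (simp add: matrix_act)
      have cE: "mat 1 - e i \<in> EndW A" by (intro subspace_diff subspace_EndW EndW_mat1 e_EndW i)
      have "d = 0"
      proof (rule singular_everywhere_no_fixed_vector[OF EndW_mult[OF fE cE] _ fixed])
        fix j assume j: "j < k"
        have "singular_at i (mat 1 - e i)"
          using U_nontrivial[OF i(1)] e_id[OF i(1)] by (auto simp: singular_at_def matrix_act)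
        then show "singular_at j (f ** (mat 1 - e i))"
          using singular_at_mult[OF j fE cE] sf[OF j] only[OF j] by blast
      qed
      then show ?thesis by (simp add: d_def)
    qed
    then have "(*v) f ` U i = ?K"
      using fK \<phi>(1) by (metis (no_types, lifting) image_eqI image_subsetI subsetI subset_antisym)
    from transfer[OF i this] abs show "abs_indecomposable A ?K" by simp
  qed
qed

section \<open>From nilpotent endomorphisms of a summand to the codimension of the bad set\<close>

lemma singular_block_NilEnd:
  assumes i: "i < k" and x: "x \<in> EndW A" "singular_at i x"
  shows "(\<lambda>v. e i *v (x *v v)) \<in> NilEnd A (U i)"
proof -
  have "linear (\<lambda>v. e i *v (x *v v))" by (simp add: linear_iff matrix_act)
  then have "(\<lambda>v. e i *v (x *v v)) \<in> EndRep A (U i)"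
    using x(1) e_EndW[OF i] e_mem[OF i] by (auto simp: EndRep_def EndW_iff)
  moreover obtain m where "\<And>v. v \<in> U i \<Longrightarrow> ((\<lambda>v. e i *v (x *v v)) ^^ m) v = 0"
    using block_nilpotent[OF i x] by blast
  ultimately show ?thesis
    unfolding NilEnd_def by blast
qed

lemma EndRep_extends:
  assumes i: "i < k" and f: "f \<in> EndRep A (U i)"
  obtains x where "x \<in> EndW A" "\<And>u. u \<in> U i \<Longrightarrow> x *v u = f u" "\<And>u. u \<in> U i \<Longrightarrow> e i *v (f u) = f u"
proof -
  have lin: "linear (\<lambda>w. f (e i *v w))"
    using f by (simp add: EndRep_def linear_iff matrix_act)
  define x where "x = matrix (\<lambda>w. f (e i *v w))"
  have x: "x *v w = f (e i *v w)" for w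
    unfolding x_def using lin by (simp add: matrix_works linear_matrix_vector_mul_eq)
  have fA: "f (A \<sigma> *v u) = A \<sigma> *v f u" if "u \<in> U i" for \<sigma> u
    using f that by (simp add: EndRep_def)
  have fU: "f u \<in> U i" if "u \<in> U i" for u
    using f that by (auto simp: EndRep_def)
  show ?thesis
  proof
    show "x \<in> EndW A"
      using e_EndW[OF i] fA[OF e_mem[OF i]] by (simp add: EndW_iff x)
  qed (simp_all add: x e_id[OF i] fU)
qed

text \<open>A nonsingular block kills no nonzero vector of \<open>U i\<close>, so no power of
  \<open>f\<close> could vanish there.\<close>

lemma NilEnd_singular:
  assumes i: "i < k" and f: "f \<in> NilEnd A (U i)" and x: "\<And>u. u \<in> U i \<Longrightarrow> x *v u = f u"
  shows "singular_at i x"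
proof (rule ccontr)
  assume ns: "\<not> singular_at i x"
  obtain m where m: "\<And>u. u \<in> U i \<Longrightarrow> (f ^^ m) u = 0"
    using f by (auto simp: NilEnd_def)
  have fU: "f u \<in> U i" if "u \<in> U i" for u
    using f that by (auto simp: NilEnd_def EndRep_def)
  have nz: "f u \<noteq> 0" if "u \<in> U i" "u \<noteq> 0" for u
    using ns that x by (auto simp: singular_at_def)
  obtain v where v: "v \<in> U i" "v \<noteq> 0" using U_nontrivial[OF i] by blast
  have "(f ^^ j) v \<in> U i \<and> (f ^^ j) v \<noteq> 0" for j
    by (induction j) (use v fU nz in auto)
  then show False using m[OF v(1)] by blast
qed

text \<open>The identity spans the quotient by the nilpotent endomorphisms. The contrapositive is
  what matters: when \<open>U i\<close> is not absolutely indecomposable, some element of the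
  commutant is no scalar modulo singular elements.\<close>

lemma abs_indecomposable_if_scalar_mod_singular:
  assumes i: "i < k" and scalar: "\<And>x. x \<in> EndW A \<Longrightarrow> \<exists>c. singular_at i (x - c *\<^sub>R mat 1)"
  shows "abs_indecomposable A (U i)"
proof -
  have sp: "subspace (U i)" by (rule subspace_U[OF i])
  \<comment> \<open>Linear combinations are lifted to the commutant, where singularity is stable
    under them, and then restricted to \<open>U i\<close> again.\<close>
  have comb: "(\<lambda>x. f x + c *\<^sub>R g x) \<in> NilEnd A (U i)"
    if f: "f \<in> EndRep A (U i)" and g: "g \<in> EndRep A (U i)"
      and x: "x \<in> EndW A" "\<And>u. u \<in> U i \<Longrightarrow> x *v u = f u" "\<And>u. u \<in> U i \<Longrightarrow> e i *v (f u) = f u"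
      and y: "y \<in> EndW A" "\<And>u. u \<in> U i \<Longrightarrow> y *v u = g u" "\<And>u. u \<in> U i \<Longrightarrow> e i *v (g u) = g u"
      and s: "singular_at i (x + c *\<^sub>R y)" for f g c x y
  proof (rule NilEnd_cong[OF singular_block_NilEnd[OF i _ s]])
    show "x + c *\<^sub>R y \<in> EndW A" by (intro subspace_add subspace_scale subspace_EndW x y)
    show "(\<lambda>x. f x + c *\<^sub>R g x) \<in> EndRep A (U i)" by (rule EndRep_lincomb[OF sp f g])
    show "f u + c *\<^sub>R g u = e i *v ((x + c *\<^sub>R y) *v u)" if "u \<in> U i" for u
      using that x y by (simp add: matrix_act scaleR_matrix_act)
  qed
  have id: "(\<lambda>x. x) \<in> EndRep A (U i)" by (simp add: EndRep_def linear_ident)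
  have "(\<lambda>x. f x + c *\<^sub>R g x) \<in> NilEnd A (U i)" if fg: "f \<in> NilEnd A (U i)" "g \<in> NilEnd A (U i)" for f g c
  proof -
    have f: "f \<in> EndRep A (U i)" and g: "g \<in> EndRep A (U i)" using fg by (auto simp: NilEnd_def)
    obtain x where x: "x \<in> EndW A" "\<And>u. u \<in> U i \<Longrightarrow> x *v u = f u" "\<And>u. u \<in> U i \<Longrightarrow> e i *v (f u) = f u"
      using EndRep_extends[OF i f] by metis
    obtain y where y: "y \<in> EndW A" "\<And>u. u \<in> U i \<Longrightarrow> y *v u = g u" "\<And>u. u \<in> U i \<Longrightarrow> e i *v (g u) = g u"
      using EndRep_extends[OF i g] by metis
    have "singular_at i (x + c *\<^sub>R y)"
      by (intro singular_at_add i x y singular_at_scaleR subspace_scale[OF subspace_EndW]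
          NilEnd_singular[OF i fg(1) x(2)] NilEnd_singular[OF i fg(2) y(2)])
    from comb[OF f g x y this] show ?thesis .
  qed
  moreover have "(\<lambda>x. x) \<notin> NilEnd A (U i)"
  proof
    assume "(\<lambda>x. x) \<in> NilEnd A (U i)"
    then have "singular_at i (mat 1)" by (rule NilEnd_singular[OF i]) simp
    then show False using not_singular_at_1[OF i] by simp
  qed
  moreover have "\<exists>c. (\<lambda>x. f x - c *\<^sub>R x) \<in> NilEnd A (U i)" if f: "f \<in> EndRep A (U i)" for f
  proof -
    obtain x where x: "x \<in> EndW A" "\<And>u. u \<in> U i \<Longrightarrow> x *v u = f u" "\<And>u. u \<in> U i \<Longrightarrow> e i *v (f u) = f u"
      using EndRep_extends[OF i f] by metis
    obtain c where c: "singular_at i (x - c *\<^sub>R mat 1)" using scalar[OF x(1)] by blast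
    have "(\<lambda>x. f x + (- c) *\<^sub>R x) \<in> NilEnd A (U i)"
      by (rule comb[OF f id x EndW_mat1]) (use c e_id[OF i] in auto)
    then show ?thesis by auto
  qed
  ultimately show ?thesis
    using indec[OF i] id unfolding abs_indecomposable_def by blast
qed

text \<open>Codimension at least two is certified by a plane meeting the subspace only in zero. For
  two singular indices it is spanned by the two projections; for one index with \<open>U i\<close>
  not absolutely indecomposable, by the identity and an element that is not scalar modulo singular
  elements.\<close>

lemma bad_set_codim2_union:
  obtains F where "finite F"
    "\<And>Q. Q \<in> F \<Longrightarrow> subspace Q \<and> (\<exists>p\<in>EndW A. \<exists>q\<in>EndW A.
          \<forall>x y. x *\<^sub>R p + y *\<^sub>R q \<in> Q \<longrightarrow> x = 0 \<and> y = 0)"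
    "\<And>L. L \<in> EndW A \<Longrightarrow> invertible L \<or> abs_indecomposable A (gen_ker L) \<longleftrightarrow> L \<notin> \<Union>F"
proof -
  define Q where "Q i = {x \<in> EndW A. singular_at i x}" for i
  define F1 where "F1 = (\<lambda>(i, j). Q i \<inter> Q j) ` {(i, j) \<in> {..<k} \<times> {..<k}. i \<noteq> j}"
  define F2 where "F2 = Q ` {i \<in> {..<k}. \<not> abs_indecomposable A (U i)}"
  have sp: "subspace (Q i)" if "i < k" for i
    unfolding Q_def by (rule subspace_singular_at[OF that])
  show ?thesis
  proof
    show "finite (F1 \<union> F2)"
    proof -
      have "finite {(i, j) \<in> {..<k} \<times> {..<k}. i \<noteq> j}"
        by (rule finite_subset[of _ "{..<k} \<times> {..<k}"]) auto
      then show ?thesis by (simp add: F1_def F2_def)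
    qed
  next
    fix S assume "S \<in> F1 \<union> F2"
    then show "subspace S \<and> (\<exists>p\<in>EndW A. \<exists>q\<in>EndW A.
          \<forall>x y. x *\<^sub>R p + y *\<^sub>R q \<in> S \<longrightarrow> x = 0 \<and> y = 0)"
    proof
      assume "S \<in> F1"
      then obtain i j where ij: "i < k" "j < k" "i \<noteq> j" "S = Q i \<inter> Q j"
        by (auto simp: F1_def)
      have zero: "x = 0" if m: "m < k" "n < k" "m \<noteq> n" and s: "singular_at m (x *\<^sub>R e m + y *\<^sub>R e n)" for m n x y
      proof -
        obtain v where v: "v \<in> U m" "v \<noteq> 0" "e m *v ((x *\<^sub>R e m + y *\<^sub>R e n) *v v) = 0"
          using s by (auto simp: singular_at_def)
        have "e n *v v = 0" using e_orth[of n m v] v m by auto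
        then have "x *\<^sub>R v = 0"
          using v e_id[OF m(1) v(1)] by (simp add: matrix_act scaleR_matrix_act)
        then show ?thesis using v(2) by simp
      qed
      have "x = 0 \<and> y = 0" if "x *\<^sub>R e i + y *\<^sub>R e j \<in> S" for x y
        using zero[of i j x y] zero[of j i y x] that ij by (auto simp: Q_def add.commute)
      moreover have "subspace S" using ij sp by (simp add: subspace_inter)
      ultimately show ?thesis using e_EndW ij(1,2) by blast
    next
      assume "S \<in> F2"
      then obtain i where i: "i < k" "S = Q i" and na: "\<not> abs_indecomposable A (U i)"
        by (auto simp: F2_def)
      obtain q where q: "q \<in> EndW A" "\<And>c. \<not> singular_at i (q - c *\<^sub>R mat 1)"
        using abs_indecomposable_if_scalar_mod_singular[OF i(1)] na by blast
      have "x = 0 \<and> y = 0" if S: "x *\<^sub>R mat 1 + y *\<^sub>R q \<in> S" for x y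
      proof -
        have s: "singular_at i (x *\<^sub>R mat 1 + y *\<^sub>R q)" using S i by (simp add: Q_def)
        have y: "y = 0"
        proof (rule ccontr)
          assume y: "y \<noteq> 0"
          have "(1 / y) *\<^sub>R (x *\<^sub>R mat 1 + y *\<^sub>R q) = q - (- (x / y)) *\<^sub>R mat 1"
            using y by (simp add: scaleR_add_right)
          then show False using singular_at_scaleR[OF s, of "1 / y"] q(2) by metis
        qed
        have "x = 0"
        proof (rule ccontr)
          assume x: "x \<noteq> 0"
          have "(1 / x) *\<^sub>R (x *\<^sub>R mat 1 + y *\<^sub>R q) = mat 1" using x y by simp
          then show False using singular_at_scaleR[OF s, of "1 / x"] not_singular_at_1[OF i(1)] by metis
        qed
        then show ?thesis using y by simp
      qed
      then show ?thesis using sp[OF i(1)] i(2) q(1) EndW_mat1 by blast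
    qed
  next
    fix L assume L: "L \<in> EndW A"
    have "L \<in> \<Union>(F1 \<union> F2) \<longleftrightarrow> (\<exists>i<k. \<exists>j<k. i \<noteq> j \<and> singular_at i L \<and> singular_at j L)
        \<or> (\<exists>i<k. \<not> abs_indecomposable A (U i) \<and> singular_at i L)"
      using L by (auto simp: F1_def F2_def Q_def)
    then show "invertible L \<or> abs_indecomposable A (gen_ker L) \<longleftrightarrow> L \<notin> \<Union>(F1 \<union> F2)"
      unfolding invertible_iff[OF L] abs_indecomposable_gen_ker_iff[OF L] by blast
  qed
qed

end

section \<open>Curves avoiding subspaces of codimension two\<close>

text \<open>Monotonicity alone gives integrability, so \<open>h\<close> may be discontinuous. The
  tail integral satisfies the hypotheses on \<open>h\<close> again, which permits a second
  application.\<close>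

lemma antimono_tail_integral:
  fixes h :: "real \<Rightarrow> real"
  assumes ab: "a < b"
    and anti: "\<And>s t. a \<le> s \<Longrightarrow> s \<le> t \<Longrightarrow> t \<le> b \<Longrightarrow> h t \<le> h s"
    and pos: "\<And>t. a \<le> t \<Longrightarrow> t < b \<Longrightarrow> 0 < h t"
    and nonneg: "0 \<le> h b"
  defines "F \<equiv> \<lambda>t. integral {t..b} h"
  shows "\<And>s t. a \<le> s \<Longrightarrow> s \<le> t \<Longrightarrow> t \<le> b \<Longrightarrow> F t \<le> F s"
    and "\<And>t. a \<le> t \<Longrightarrow> t < b \<Longrightarrow> 0 < F t"
    and "F b = 0"
    and "\<And>t. a \<le> t \<Longrightarrow> t \<le> b \<Longrightarrow> F t \<le> (b - a) * h t"
    and "continuous_on {a..b} F"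
proof -
  have h0: "0 \<le> h t" if "a \<le> t" "t \<le> b" for t
    using that pos nonneg by (cases "t = b") (auto simp: less_imp_le)
  have "mono_on {a..b} (\<lambda>t. - h t)"
    using anti by (auto simp: mono_on_def)
  then have "h integrable_on {a..b}"
    using integrable_on_mono_on integrable_neg_iff by blast
  then have int: "h integrable_on {s..t}" if "a \<le> s" "t \<le> b" for s t
    by (rule integrable_subinterval_real) (use that in auto)
  have split: "F s = integral {s..t} h + F t" if "a \<le> s" "s \<le> t" "t \<le> b" for s t
    using Henstock_Kurzweil_Integration.integral_combine[OF that(2,3) int[of s b]] that by (simp add: F_def)
  have I0: "0 \<le> integral {s..t} h" if "a \<le> s" "t \<le> b" for s t
    by (rule integral_nonneg[OF int[OF that]]) (use that h0 in auto)
  show mono: "F t \<le> F s" if "a \<le> s" "s \<le> t" "t \<le> b" for s t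
    using split[OF that] I0[of s t] that by simp
  show Fb: "F b = 0"
    by (simp add: F_def)
  show "0 < F t" if t: "a \<le> t" "t < b" for t
  proof -
    \<comment> \<open>Since \<open>h\<close> may vanish at \<open>b\<close>, the integral is bounded
      below on the first half of the interval only, where \<open>h\<close> is at least
      \<open>h s\<close>.\<close>
    define s where "s = (t + b) / 2"
    have s: "t < s" "s < b" using t by (auto simp: s_def)
    have "integral {t..s} (\<lambda>_. h s) \<le> integral {t..s} h"
      by (rule integral_le[OF _ int]) (use s t anti in auto)
    then have "(s - t) * h s \<le> integral {t..s} h"
      using s by simp
    moreover have "0 < (s - t) * h s"
      using s t pos by simp
    moreover have "0 \<le> F s"
      using mono[of s b] Fb s t by simp
    ultimately show ?thesis
      using split[of t s] s t by simp
  qed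
  show "F t \<le> (b - a) * h t" if t: "a \<le> t" "t \<le> b" for t
  proof -
    have "F t \<le> integral {t..b} (\<lambda>_. h t)"
      unfolding F_def by (rule integral_le[OF int]) (use t anti in auto)
    also have "\<dots> = (b - t) * h t" using t by simp
    also have "\<dots> \<le> (b - a) * h t" using t h0 by (simp add: mult_right_mono)
    finally show ?thesis .
  qed
  show "continuous_on {a..b} F"
    unfolding F_def using int[of a b] indefinite_integral_continuous_1' by auto
qed

text \<open>The running infimum \<open>h\<close> of \<open>\<delta>\<close> is decreasing. Its tail integral \<open>H\<close> is continuous, decreasing and
  bounded by a multiple of \<open>h\<close>, so the tail integral of \<open>H\<close> is \<open>C\<^sup>1\<close> and controlled by \<open>\<delta>\<close> together
  with its derivative \<open>- H\<close>.\<close>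

lemma C1_right_minorant:
  fixes \<delta> :: "real \<Rightarrow> real"
  assumes c: "a < c" "c < b" and "pos_cont a b \<delta>"
  obtains \<phi> \<phi>' C where "0 < C" "continuous_on {a<..<b} \<phi>'"
    "\<And>t. t \<in> {a<..<b} \<Longrightarrow> (\<phi> has_real_derivative \<phi>' t) (at t)"
    "\<And>t. t \<in> {a<..<b} \<Longrightarrow> 0 < \<phi> t \<and> \<phi> t \<le> C \<and> \<bar>\<phi>' t\<bar> \<le> C"
    "\<And>t. c \<le> t \<Longrightarrow> t < b \<Longrightarrow> \<phi> t \<le> C * \<delta> t \<and> \<bar>\<phi>' t\<bar> \<le> C * \<delta> t"
proof -
  have cont: "continuous_on {a<..<b} \<delta>" and pos: "\<And>t. t \<in> {a<..<b} \<Longrightarrow> 0 < \<delta> t"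
    using assms by (auto simp: pos_cont_def)
  \<comment> \<open>\<open>max c t\<close> makes \<open>h\<close> constant to the left of
    \<open>c\<close>, so the behaviour of \<open>\<delta>\<close> near \<open>a\<close> does not
    matter. The value 0 from \<open>b\<close> on keeps \<open>h\<close> decreasing up to the
    endpoint.\<close>
  define h where "h t = (if t < b then Inf (\<delta> ` {c..max c t}) else 0)" for t
  have at: "\<exists>s\<in>{c..max c t}. h t = \<delta> s \<and> (\<forall>u\<in>{c..max c t}. \<delta> s \<le> \<delta> u)" if "t < b" for t
  proof -
    have "continuous_on {c..max c t} \<delta>"
      by (rule continuous_on_subset[OF cont]) (use c that in auto)
    then obtain s where s: "s \<in> {c..max c t}" "\<forall>u\<in>{c..max c t}. \<delta> s \<le> \<delta> u"
      using continuous_attains_inf[of "{c..max c t}" \<delta>] by auto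
    then have "Inf (\<delta> ` {c..max c t}) = \<delta> s"
      by (intro cInf_eq_minimum) auto
    then show ?thesis using s that by (auto simp: h_def)
  qed
  have hpos: "0 < h t" if "a \<le> t" "t < b" for t
    using at[OF that(2)] pos that c by auto
  have anti: "h t \<le> h s" if "a \<le> s" "s \<le> t" "t \<le> b" for s t
  proof (cases "t < b")
    case True
    then have "s < b" using that by simp
    with at[OF this] obtain u where "u \<in> {c..max c s}" "h s = \<delta> u" by blast
    moreover have "{c..max c s} \<subseteq> {c..max c t}" using that by auto
    ultimately show ?thesis using at[OF True] by (metis subsetD)
  next
    case False
    then show ?thesis using that hpos[of s] by (cases "s < b") (auto simp: h_def)
  qed
  have hle: "h t \<le> \<delta> t" if "c \<le> t" "t < b" for t
    using at[OF that(2)] that by auto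
  have hb: "0 \<le> h b" by (simp add: h_def)
  have ab: "a < b" using c by simp
  define H where "H t = integral {t..b} h" for t
  have H: "\<And>s t. a \<le> s \<Longrightarrow> s \<le> t \<Longrightarrow> t \<le> b \<Longrightarrow> H t \<le> H s"
      "\<And>t. a \<le> t \<Longrightarrow> t < b \<Longrightarrow> 0 < H t" "H b = 0"
      "\<And>t. a \<le> t \<Longrightarrow> t \<le> b \<Longrightarrow> H t \<le> (b - a) * h t" "continuous_on {a..b} H"
    unfolding H_def by (rule antimono_tail_integral[of a b h, OF ab anti hpos hb]; assumption)+
  define \<phi> where "\<phi> t = integral {t..b} H" for t
  have P: "\<And>t. a \<le> t \<Longrightarrow> t < b \<Longrightarrow> 0 < \<phi> t"
      "\<And>t. a \<le> t \<Longrightarrow> t \<le> b \<Longrightarrow> \<phi> t \<le> (b - a) * H t"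
    unfolding \<phi>_def by (rule antimono_tail_integral[of a b H, OF ab H(1,2)]; simp add: H(3))+
  have deriv: "(\<phi> has_real_derivative - H t) (at t)" if t: "t \<in> {a<..<b}" for t
  proof -
    have "((\<lambda>u. integral {u..b} H) has_vector_derivative - H t) (at t within {a..b})"
      by (rule integral_has_vector_derivative'[OF H(5)]) (use t in auto)
    then have "(\<phi> has_vector_derivative - H t) (at t within {a<..<b})"
      unfolding \<phi>_def[abs_def] by (rule has_vector_derivative_within_subset) auto
    then show ?thesis
      unfolding at_within_open[OF t open_greaterThanLessThan]
        has_real_derivative_iff_has_vector_derivative .
  qed
  define D where "D = b - a"
  have D: "0 < D" using ab by (simp add: D_def)
  \<comment> \<open>The factor \<open>D * (1 + D)\<close> bounds both \<open>\<phi>\<close> and its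
    derivative in terms of \<open>h\<close>. The factor \<open>1 + h a\<close> turns this into a
    uniform bound as well, because \<open>h\<close> is at most \<open>h a\<close>.\<close>
  define C where "C = D * (1 + D) * (1 + h a)"
  have ha: "0 < h a" using hpos ab by simp
  have est: "\<phi> t \<le> D * (1 + D) * h t" "\<bar>- H t\<bar> \<le> D * (1 + D) * h t" if t: "a \<le> t" "t < b" for t
  proof -
    have 1: "H t \<le> D * h t" and 2: "\<phi> t \<le> D * H t" and 3: "0 < H t" and 4: "0 < h t"
      using t H(2,4) P(2) hpos by (auto simp: D_def)
    have "D * H t \<le> D * (D * h t)" using 1 D by simp
    then show "\<phi> t \<le> D * (1 + D) * h t" "\<bar>- H t\<bar> \<le> D * (1 + D) * h t"
      using 1 2 3 mult_pos_pos[OF D 4] mult_pos_pos[OF D mult_pos_pos[OF D 4]]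
      by (simp_all add: algebra_simps)
  qed
  have C: "D * (1 + D) \<le> C"
    unfolding C_def using D ha by (simp add: algebra_simps)
  show ?thesis
  proof
    show "0 < C" unfolding C_def using D ha by simp
    show "continuous_on {a<..<b} (\<lambda>t. - H t)"
      by (intro continuous_intros continuous_on_subset[OF H(5)]) auto
    show "(\<phi> has_real_derivative - H t) (at t)" if "t \<in> {a<..<b}" for t
      by (rule deriv[OF that])
    show "0 < \<phi> t \<and> \<phi> t \<le> C \<and> \<bar>- H t\<bar> \<le> C" if "t \<in> {a<..<b}" for t
    proof -
      have "D * (1 + D) * h t \<le> D * (1 + D) * (1 + h a)"
        using anti[of a t] that D by (intro mult_left_mono) auto
      then show ?thesis using est[of t] that P(1)[of t] by (auto simp: C_def)
    qed
    show "\<phi> t \<le> C * \<delta> t \<and> \<bar>- H t\<bar> \<le> C * \<delta> t" if t: "c \<le> t" "t < b" for t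
    proof -
      have "D * (1 + D) * h t \<le> D * (1 + D) * \<delta> t"
        using hle[OF t] D by (intro mult_left_mono) auto
      also have "\<dots> \<le> C * \<delta> t"
        by (rule mult_right_mono[OF C]) (use pos[of t] t c in auto)
      finally show ?thesis using est[of t] t c by auto
    qed
  qed
qed

text \<open>The mirror image of \<open>C1_right_minorant\<close> under the reflection of the line at
  0.\<close>

lemma C1_left_minorant:
  fixes \<delta> :: "real \<Rightarrow> real"
  assumes c: "a < c" "c < b" and "pos_cont a b \<delta>"
  obtains \<phi> \<phi>' C where "0 < C" "continuous_on {a<..<b} \<phi>'"
    "\<And>t. t \<in> {a<..<b} \<Longrightarrow> (\<phi> has_real_derivative \<phi>' t) (at t)"
    "\<And>t. t \<in> {a<..<b} \<Longrightarrow> 0 < \<phi> t \<and> \<phi> t \<le> C \<and> \<bar>\<phi>' t\<bar> \<le> C"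
    "\<And>t. a < t \<Longrightarrow> t \<le> c \<Longrightarrow> \<phi> t \<le> C * \<delta> t \<and> \<bar>\<phi>' t\<bar> \<le> C * \<delta> t"
proof -
  have cont: "continuous_on {a<..<b} \<delta>" and pos: "\<And>t. t \<in> {a<..<b} \<Longrightarrow> 0 < \<delta> t"
    using assms by (auto simp: pos_cont_def)
  have "continuous_on {-b<..<-a} (\<lambda>t. \<delta> (- t))"
    by (rule continuous_on_compose2[OF cont]) (auto intro!: continuous_intros)
  then have refl: "pos_cont (- b) (- a) (\<lambda>t. \<delta> (- t))"
    using pos by (auto simp: pos_cont_def)
  have c': "- b < - c" "- c < - a" using c by auto
  obtain \<phi> \<phi>' C where C: "0 < C" "continuous_on {-b<..<-a} \<phi>'"
    "\<And>t. t \<in> {-b<..<-a} \<Longrightarrow> (\<phi> has_real_derivative \<phi>' t) (at t)"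
    "\<And>t. t \<in> {-b<..<-a} \<Longrightarrow> 0 < \<phi> t \<and> \<phi> t \<le> C \<and> \<bar>\<phi>' t\<bar> \<le> C"
    "\<And>t. -c \<le> t \<Longrightarrow> t < -a \<Longrightarrow> \<phi> t \<le> C * \<delta> (-t) \<and> \<bar>\<phi>' t\<bar> \<le> C * \<delta> (-t)"
    using C1_right_minorant[OF c' refl] by metis
  show ?thesis
  proof (rule that[of C "\<lambda>t. - \<phi>' (- t)" "\<lambda>t. \<phi> (- t)"])
    show "continuous_on {a<..<b} (\<lambda>t. - \<phi>' (- t))"
      by (intro continuous_intros continuous_on_compose2[OF C(2)]) auto
    show "((\<lambda>t. \<phi> (- t)) has_real_derivative - \<phi>' (- t)) (at t)" if "t \<in> {a<..<b}" for t
    proof -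
      have "(\<phi> has_real_derivative \<phi>' (- t)) (at (- t))"
        by (rule C(3)) (use that in auto)
      then have "((\<lambda>t. \<phi> (- t)) has_real_derivative \<phi>' (- t) * (- 1)) (at t)"
        by (rule DERIV_chain2) (auto intro!: derivative_eq_intros)
      then show ?thesis by simp
    qed
  qed (use C(1,4) C(5)[of "- _"] in auto)
qed

text \<open>The product of a right and a left minorant: on either side of the midpoint one factor is
  controlled by \<open>\<delta>\<close>, together with its derivative, while the other one stays
  bounded.\<close>

lemma C1_minorant:
  fixes \<delta> :: "real \<Rightarrow> real"
  assumes ab: "a < b" and \<delta>: "pos_cont a b \<delta>"
  obtains \<phi> \<phi>' where "continuous_on {a<..<b} \<phi>'"
    "\<And>t. t \<in> {a<..<b} \<Longrightarrow> (\<phi> has_real_derivative \<phi>' t) (at t)"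
    "\<And>t. t \<in> {a<..<b} \<Longrightarrow> 0 < \<phi> t \<and> \<phi> t < \<delta> t \<and> \<bar>\<phi>' t\<bar> < \<delta> t"
proof -
  define c where "c = (a + b) / 2"
  have c: "a < c" "c < b" using ab by (auto simp: c_def)
  obtain p p' C where p: "0 < C" "continuous_on {a<..<b} p'"
    "\<And>t. t \<in> {a<..<b} \<Longrightarrow> (p has_real_derivative p' t) (at t)"
    "\<And>t. t \<in> {a<..<b} \<Longrightarrow> 0 < p t \<and> p t \<le> C \<and> \<bar>p' t\<bar> \<le> C"
    "\<And>t. c \<le> t \<Longrightarrow> t < b \<Longrightarrow> p t \<le> C * \<delta> t \<and> \<bar>p' t\<bar> \<le> C * \<delta> t"
    using C1_right_minorant[OF c \<delta>] by metis
  obtain q q' B where q: "0 < B" "continuous_on {a<..<b} q'"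
    "\<And>t. t \<in> {a<..<b} \<Longrightarrow> (q has_real_derivative q' t) (at t)"
    "\<And>t. t \<in> {a<..<b} \<Longrightarrow> 0 < q t \<and> q t \<le> B \<and> \<bar>q' t\<bar> \<le> B"
    "\<And>t. a < t \<Longrightarrow> t \<le> c \<Longrightarrow> q t \<le> B * \<delta> t \<and> \<bar>q' t\<bar> \<le> B * \<delta> t"
    using C1_left_minorant[OF c \<delta>] by metis
  \<comment> \<open>The derivative of the product has two terms of size at most
    \<open>B * C * \<delta> t\<close>; the 3 makes the final estimate strict.\<close>
  define K where "K = 3 * B * C"
  have K: "0 < K" using p(1) q(1) by (simp add: K_def)
  have bound: "\<bar>x\<bar> * \<bar>y\<bar> \<le> B * C * \<delta> t"
    if t: "t \<in> {a<..<b}" and x: "x \<in> {p t, p' t}" and y: "y \<in> {q t, q' t}" for x y t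
  proof (cases "c \<le> t")
    case True
    then have "\<bar>x\<bar> \<le> C * \<delta> t" "\<bar>y\<bar> \<le> B"
      using x y p(4,5)[of t] q(4)[of t] t by auto
    then have "\<bar>x\<bar> * \<bar>y\<bar> \<le> (C * \<delta> t) * B" by (intro mult_mono) auto
    then show ?thesis by (simp add: ac_simps)
  next
    case False
    then have "\<bar>x\<bar> \<le> C" "\<bar>y\<bar> \<le> B * \<delta> t"
      using x y p(4)[of t] q(4,5)[of t] t by auto
    then have "\<bar>x\<bar> * \<bar>y\<bar> \<le> C * (B * \<delta> t)" using p(1) by (intro mult_mono) auto
    then show ?thesis by (simp add: ac_simps)
  qed
  show ?thesis
  proof
    show "continuous_on {a<..<b} (\<lambda>t. (p' t * q t + q' t * p t) / K)"
    proof -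
      have "continuous_on {a<..<b} p" "continuous_on {a<..<b} q"
        using p(3) q(3) by (meson continuous_at_imp_continuous_on DERIV_isCont)+
      then show ?thesis using p(2) q(2) K by (auto intro!: continuous_intros)
    qed
    fix t assume t: "t \<in> {a<..<b}"
    show "((\<lambda>t. p t * q t / K) has_real_derivative (p' t * q t + q' t * p t) / K) (at t)"
      by (rule DERIV_cdivide[OF DERIV_mult[OF p(3) q(3)]]) (use t in auto)
    have \<delta>t: "0 < \<delta> t" using \<delta> t by (auto simp: pos_cont_def)
    have BC: "0 < B * C * \<delta> t" using p(1) q(1) \<delta>t by simp
    have 1: "p t * q t \<le> B * C * \<delta> t"
      using bound[OF t, of "p t" "q t"] p(4)[OF t] q(4)[OF t] by simp
    have 2: "\<bar>p' t * q t\<bar> \<le> B * C * \<delta> t" "\<bar>q' t * p t\<bar> \<le> B * C * \<delta> t"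
      using bound[OF t, of "p' t" "q t"] bound[OF t, of "p t" "q' t"]
      by (auto simp: abs_mult mult.commute)
    have "\<bar>p' t * q t + q' t * p t\<bar> < K * \<delta> t"
      using 2 BC by (simp add: K_def)
    moreover have "p t * q t < K * \<delta> t" using 1 BC by (simp add: K_def)
    ultimately show "0 < p t * q t / K \<and> p t * q t / K < \<delta> t
        \<and> \<bar>(p' t * q t + q' t * p t) / K\<bar> < \<delta> t"
      using K p(4)[OF t] q(4)[OF t] by (simp add: divide_less_eq mult.commute)
  qed
qed

section \<open>Neighbourhoods of curves and perturbation off a subspace\<close>

lemma C1_curve_continuous_on:
  assumes "C1_curve A a b L"
  shows "continuous_on {a<..<b} L"
  using assms unfolding C1_curve_def
  by (meson continuous_at_imp_continuous_on has_vector_derivative_continuous)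

lemma C1_nbhd_trans:
  fixes L M N :: "real \<Rightarrow> real^'n^'n"
  assumes "M \<in> C1_nbhd a b L \<delta>" "N \<in> C1_nbhd a b M \<epsilon>"
  shows "N \<in> C1_nbhd a b L (\<lambda>t. \<delta> t + \<epsilon> t)"
  unfolding C1_nbhd_def
proof (intro CollectI ballI)
  fix t assume t: "t \<in> {a<..<b}"
  have tri: "norm (z - x) < d + e" if "norm (y - x) < d" "norm (z - y) < e"
    for x y z :: "real^'n^'n" and d e
    using norm_triangle_ineq[of "z - y" "y - x"] that by simp
  show "norm (N t - L t) < \<delta> t + \<epsilon> t \<and>
      norm (vector_derivative N (at t) - vector_derivative L (at t)) < \<delta> t + \<epsilon> t"
    using assms t unfolding C1_nbhd_def by (blast intro: tri)
qed

lemma C1_nbhd_mono: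
  assumes "M \<in> C1_nbhd a b L \<delta>" "\<And>t. t \<in> {a<..<b} \<Longrightarrow> \<delta> t \<le> \<epsilon> t"
  shows "M \<in> C1_nbhd a b L \<epsilon>"
  using assms unfolding C1_nbhd_def by (auto intro: less_le_trans)

text \<open>The distance from \<open>L t\<close> to \<open>S\<close> is itself an admissible error
  function. It may tend to zero at the ends of the interval, which the strong topology
  tolerates.\<close>

lemma C1_nbhd_avoids_closed:
  fixes L :: "real \<Rightarrow> real^'n^'n"
  assumes "closed S" "continuous_on {a<..<b} L" "\<And>t. t \<in> {a<..<b} \<Longrightarrow> L t \<notin> S"
  obtains \<delta> where "pos_cont a b \<delta>"
    "\<And>M t. M \<in> C1_nbhd a b L \<delta> \<Longrightarrow> t \<in> {a<..<b} \<Longrightarrow> M t \<notin> S"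
proof (cases "S = {}")
  case True
  \<comment> \<open>By convention \<open>infdist\<close> to the empty set is 0, so this case needs
    another error function.\<close>
  then show ?thesis by (intro that[of "\<lambda>_. 1"]) (auto simp: pos_cont_def)
next
  case False
  show ?thesis
  proof
    show "pos_cont a b (\<lambda>t. infdist (L t) S)"
      using assms False by (auto simp: pos_cont_def intro!: continuous_intros infdist_pos_not_in_closed)
    show "M t \<notin> S" if "M \<in> C1_nbhd a b L (\<lambda>t. infdist (L t) S)" "t \<in> {a<..<b}" for M t
    proof
      assume "M t \<in> S"
      then have "infdist (L t) S \<le> norm (M t - L t)"
        by (metis infdist_le dist_norm norm_minus_commute)
      then show False using that by (auto simp: C1_nbhd_def not_less[symmetric])
    qed
  qed
qed

text \<open>A basis of \<open>Q\<close> stays independent after adding \<open>p\<close> and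
  \<open>q\<close>, so values on it can be prescribed. The complex numbers serve as the real
  plane.\<close>

lemma functional_vanishing_on_codim2:
  fixes p q :: "'v::real_vector"
  assumes Q: "subspace Q" and pq: "\<And>a b. a *\<^sub>R p + b *\<^sub>R q \<in> Q \<Longrightarrow> a = 0 \<and> b = 0"
  obtains l :: "'v \<Rightarrow> complex" where "linear l" "\<And>x. x \<in> Q \<Longrightarrow> l x = 0" "l p = 1" "l q = \<i>"
proof -
  obtain B where B: "B \<subseteq> Q" "independent B" "Q \<subseteq> span B"
    using maximal_independent_subset by blast
  have span: "span B = Q"
    using B Q by (simp add: span_minimal subset_antisym)
  have p: "p \<notin> span B"
    using pq[of 1 0] by (auto simp: span)
  have q: "q \<notin> span (insert p B)"
  proof
    assume "q \<in> span (insert p B)"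
    then obtain k where "q - k *\<^sub>R p \<in> Q"
      by (auto simp: span_insert span)
    then show False using pq[of "- k" 1] by simp
  qed
  have "independent (insert q (insert p B))"
    using B(2) p q independent_insertI by blast
  then obtain l where l: "linear l"
    "\<forall>x\<in>insert q (insert p B). l x = (if x = p then 1 else if x = q then \<i> else (0::complex))"
    using linear_independent_extend[of "insert q (insert p B)"
        "\<lambda>x. if x = p then 1 else if x = q then \<i> else 0"] by metis
  have neq: "p \<noteq> q" "p \<notin> B" "q \<notin> B"
    using p q span_base[of p "insert p B"] span_base[of q "insert p B"] span_base[of p B] by auto
  show ?thesis
  proof
    show "l x = 0" if "x \<in> Q" for x
    proof (rule linear_eq_0_on_span[OF l(1)])
      show "l y = 0" if "y \<in> B" for y using l(2) neq that by auto
    qed (use that span in simp)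
  qed (use l neq in auto)
qed

lemma C1_dense_avoids_codim2:
  fixes A :: "'a \<Rightarrow> real^'n^'n"
  assumes ab: "a < b" and L: "C1_curve A a b L" and \<delta>: "pos_cont a b \<delta>"
    and Q: "subspace Q" and p: "p \<in> EndW A" and q: "q \<in> EndW A"
    and pq: "\<And>x y. x *\<^sub>R p + y *\<^sub>R q \<in> Q \<Longrightarrow> x = 0 \<and> y = 0"
  obtains M where "C1_curve A a b M" "M \<in> C1_nbhd a b L \<delta>" "\<And>t. t \<in> {a<..<b} \<Longrightarrow> M t \<notin> Q"
proof -
  obtain l :: "real^'n^'n \<Rightarrow> complex" where
    l: "linear l" "\<And>x. x \<in> Q \<Longrightarrow> l x = 0" "l p = 1" "l q = \<i>"
    using functional_vanishing_on_codim2[of Q p q] Q pq by blast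
  obtain L' where L': "\<And>t. t \<in> {a<..<b} \<Longrightarrow> (L has_vector_derivative L' t) (at t)"
    "continuous_on {a<..<b} L'"
    using L unfolding C1_curve_def by blast
  \<comment> \<open>A strict bound for the norm of every vector \<open>v\<close> with coordinates in
    the unit disc; the 1 makes it strict and positive.\<close>
  define K where "K = norm p + norm q + 1"
  have K: "0 < K" by (simp add: K_def add_nonneg_pos)
  have "pos_cont a b (\<lambda>t. \<delta> t / K)"
    using \<delta> K by (auto simp: pos_cont_def intro!: continuous_intros)
  then obtain \<phi> \<phi>' where \<phi>: "continuous_on {a<..<b} \<phi>'"
    "\<And>t. t \<in> {a<..<b} \<Longrightarrow> (\<phi> has_real_derivative \<phi>' t) (at t)"
    "\<And>t. t \<in> {a<..<b} \<Longrightarrow> 0 < \<phi> t \<and> \<phi> t < \<delta> t / K \<and> \<bar>\<phi>' t\<bar> < \<delta> t / K"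
    using C1_minorant[OF ab] by metis
  \<comment> \<open>The curve of forbidden parameters: the perturbed curve can meet \<open>Q\<close>
    at time \<open>t\<close> only if \<open>l v\<close> equals \<open>?g t\<close>.\<close>
  let ?g = "\<lambda>t. - (1 / \<phi> t) *\<^sub>R l (L t)"
  have "?g differentiable_on {a<..<b}"
    unfolding differentiable_on_def
  proof
    fix t assume t: "t \<in> {a<..<b}"
    have "L differentiable (at t within {a<..<b})"
      using L'(1)[OF t] differentiableI_vector differentiable_at_withinI by blast
    then have "(\<lambda>t. l (L t)) differentiable (at t within {a<..<b})"
      using differentiable_compose[OF linear_imp_differentiable[OF l(1)]] by blast
    moreover have "\<phi> differentiable (at t within {a<..<b})"
      using \<phi>(2)[OF t] real_differentiable_def differentiable_at_withinI by blast
    ultimately show "?g differentiable (at t within {a<..<b})"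
      using \<phi>(3)[OF t] by (intro derivative_intros) auto
  qed
  then have "negligible (?g ` {a<..<b})"
    by (rule negligible_differentiable_image_lowdim[rotated]) simp
  \<comment> \<open>A disc is not a null set, so an admissible parameter exists in it; restricting
    to the unit disc keeps the perturbation small.\<close>
  then have "\<not> ball 0 1 \<subseteq> ?g ` {a<..<b}"
    using negligible_subset open_not_negligible[OF open_ball, of "0::complex" 1]
    by (metis ball_eq_empty not_one_le_zero)
  then obtain c where "c \<in> ball 0 1" and c': "c \<notin> ?g ` {a<..<b}"
    by (meson subsetI)
  then have c: "norm c < 1"
    by simp
  define v where "v = Re c *\<^sub>R p + Im c *\<^sub>R q"
  have lv: "l v = c"
    using l by (simp add: v_def linear_add linear_scale complex_eq_iff)
  have "norm v \<le> \<bar>Re c\<bar> * norm p + \<bar>Im c\<bar> * norm q"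
    unfolding v_def by (metis norm_scaleR norm_triangle_ineq)
  also have "\<dots> \<le> norm p + norm q"
    using c abs_Re_le_cmod[of c] abs_Im_le_cmod[of c]
    by (intro add_mono mult_left_le_one_le) auto
  finally have v: "norm v < K" by (simp add: K_def)
  have vE: "v \<in> EndW A"
    unfolding v_def using p q by (intro subspace_add subspace_scale subspace_EndW)
  have small: "norm (x *\<^sub>R v) < \<delta> t" if "\<bar>x\<bar> < \<delta> t / K" for x t
  proof -
    have "norm (x *\<^sub>R v) \<le> \<bar>x\<bar> * K"
      using v by (simp add: mult_left_mono)
    also have "\<dots> < \<delta> t"
      using that K by (simp add: less_divide_eq)
    finally show ?thesis .
  qed
  let ?M = "\<lambda>t. L t + \<phi> t *\<^sub>R v"
  have M': "(?M has_vector_derivative L' t + \<phi>' t *\<^sub>R v) (at t)" if "t \<in> {a<..<b}" for t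
    using L'(1)[OF that] \<phi>(2)[OF that]
    by (auto intro!: derivative_eq_intros simp: has_real_derivative_iff_has_vector_derivative)
  show ?thesis
  proof
    show "C1_curve A a b ?M"
      unfolding C1_curve_def
    proof (intro conjI ballI exI)
      show "?M t \<in> EndW A" if "t \<in> {a<..<b}" for t
        using L vE that by (auto simp: C1_curve_def intro!: subspace_add subspace_scale subspace_EndW)
      show "continuous_on {a<..<b} (\<lambda>t. L' t + \<phi>' t *\<^sub>R v)"
        by (intro continuous_intros L'(2) \<phi>(1))
    qed (rule M')
    show "?M \<in> C1_nbhd a b L \<delta>"
      unfolding C1_nbhd_def
    proof (intro CollectI ballI conjI)
      fix t assume t: "t \<in> {a<..<b}"
      show "norm (?M t - L t) < \<delta> t"
        using small[of "\<phi> t" t] \<phi>(3)[OF t] by simp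
      show "norm (vector_derivative ?M (at t) - vector_derivative L (at t)) < \<delta> t"
        using small[of "\<phi>' t" t] \<phi>(3)[OF t] vector_derivative_at[OF M'[OF t]]
          vector_derivative_at[OF L'(1)[OF t]] by simp
    qed
    show "?M t \<notin> Q" if t: "t \<in> {a<..<b}" for t
    proof
      assume "?M t \<in> Q"
      then have "l (L t) + \<phi> t *\<^sub>R c = 0"
        using l(1) l(2)[of "?M t"] lv by (simp add: linear_add linear_scale)
      then have "l (L t) = - (\<phi> t *\<^sub>R c)"
        by (simp add: eq_neg_iff_add_eq_0)
      then have "?g t = (1 / \<phi> t * \<phi> t) *\<^sub>R c"
        by (simp only: scaleR_minus_right scaleR_minus_left scaleR_scaleR minus_minus mult_minus_left)
      also have "\<dots> = c"
        using \<phi>(3)[OF t] by simp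
      finally have "c = ?g t" ..
      have "c \<in> ?g ` {a<..<b}"
        by (subst \<open>c = ?g t\<close>) (rule imageI[OF t])
      then show False using c' by contradiction
    qed
  qed
qed

text \<open>Half of the tolerance is spent on avoiding the earlier subspaces. Their union is closed,
  so the next perturbation can be chosen small enough not to meet them again.\<close>

lemma C1_dense_avoids_codim2_union:
  fixes A :: "'a \<Rightarrow> real^'n^'n"
  assumes "finite F" and ab: "a < b"
    and F: "\<And>Q. Q \<in> F \<Longrightarrow> subspace Q \<and> (\<exists>p\<in>EndW A. \<exists>q\<in>EndW A.
          \<forall>x y. x *\<^sub>R p + y *\<^sub>R q \<in> Q \<longrightarrow> x = 0 \<and> y = 0)"
    and L: "C1_curve A a b L" and \<delta>: "pos_cont a b \<delta>"
  shows "\<exists>M. C1_curve A a b M \<and> M \<in> C1_nbhd a b L \<delta> \<and> (\<forall>t\<in>{a<..<b}. M t \<notin> \<Union>F)"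
  using \<open>finite F\<close> F \<delta>
proof (induction F arbitrary: \<delta>)
  case empty
  then have "L \<in> C1_nbhd a b L \<delta>"
    by (auto simp: C1_nbhd_def pos_cont_def)
  then show ?case using L by auto
next
  case (insert Q F)
  have half: "pos_cont a b (\<lambda>t. \<delta> t / 2)"
    using insert.prems(2) by (auto simp: pos_cont_def intro!: continuous_intros)
  then obtain M where M: "C1_curve A a b M" "M \<in> C1_nbhd a b L (\<lambda>t. \<delta> t / 2)"
    "\<forall>t\<in>{a<..<b}. M t \<notin> \<Union>F"
    using insert.IH[OF _ half] insert.prems(1) by (metis insertCI)
  have "closed (\<Union>F)"
    using insert.hyps(1) insert.prems(1) closed_subspace by (intro closed_Union) auto
  then obtain \<epsilon> where \<epsilon>: "pos_cont a b \<epsilon>"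
    "\<And>N t. N \<in> C1_nbhd a b M \<epsilon> \<Longrightarrow> t \<in> {a<..<b} \<Longrightarrow> N t \<notin> \<Union>F"
    using C1_nbhd_avoids_closed[OF _ C1_curve_continuous_on[OF M(1)]] M(3) by metis
  have min: "pos_cont a b (\<lambda>t. min (\<epsilon> t) (\<delta> t / 2))"
    using half \<epsilon>(1) by (auto simp: pos_cont_def intro!: continuous_intros)
  obtain p q where "subspace Q" "p \<in> EndW A" "q \<in> EndW A"
    "\<And>x y. x *\<^sub>R p + y *\<^sub>R q \<in> Q \<Longrightarrow> x = 0 \<and> y = 0"
    using insert.prems(1)[of Q] by blast
  from C1_dense_avoids_codim2[OF ab M(1) min this]
  obtain N where N: "C1_curve A a b N" "N \<in> C1_nbhd a b M (\<lambda>t. min (\<epsilon> t) (\<delta> t / 2))"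
    "\<And>t. t \<in> {a<..<b} \<Longrightarrow> N t \<notin> Q"
    by blast
  have "N \<in> C1_nbhd a b L \<delta>"
    by (rule C1_nbhd_mono[OF C1_nbhd_trans[OF M(2) N(2)]]) auto
  moreover have "N \<in> C1_nbhd a b M \<epsilon>"
    by (rule C1_nbhd_mono[OF N(2)]) auto
  then have "N t \<notin> \<Union>F" if "t \<in> {a<..<b}" for t
    using \<epsilon>(2) that by blast
  ultimately show ?case using N(1,3) by auto
qed

theorem mainTheorem14:
  fixes A :: "'a::semigroup_mult \<Rightarrow> real^'n^'n"
    and U :: "nat \<Rightarrow> (real^'n) set" and k :: nat and l0 l1 :: real
  assumes "is_rep A"
    and "\<forall>i<k. indecomposable A (U i)"
    and "\<forall>i<k. \<forall>j<k. i \<noteq> j \<longrightarrow> \<not> rep_iso A (U i) (U j)"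
    and "internal_direct_sum U k"
    and "l0 < l1"
  shows "(\<forall>L. C1_curve A l0 l1 L \<and> general_position A l0 l1 L \<longrightarrow>
            (\<exists>\<delta>. pos_cont l0 l1 \<delta> \<and>
               (\<forall>M. C1_curve A l0 l1 M \<and> M \<in> C1_nbhd l0 l1 L \<delta> \<longrightarrow> general_position A l0 l1 M)))
       \<and> (\<forall>L \<delta>. C1_curve A l0 l1 L \<and> pos_cont l0 l1 \<delta> \<longrightarrow>
            (\<exists>M. C1_curve A l0 l1 M \<and> M \<in> C1_nbhd l0 l1 L \<delta> \<and> general_position A l0 l1 M))"
proof -
  have sub: "subrep A (U i)" if "i < k" for i
    using assms(2) that by (simp add: indecomposable_def)
  obtain e where e: "\<And>i. i < k \<Longrightarrow> e i \<in> EndW A" "\<And>i w. i < k \<Longrightarrow> e i *v w \<in> U i"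
    "\<And>i v. i < k \<Longrightarrow> v \<in> U i \<Longrightarrow> e i *v v = v"
    "\<And>i j v. i < k \<Longrightarrow> j < k \<Longrightarrow> i \<noteq> j \<Longrightarrow> v \<in> U j \<Longrightarrow> e i *v v = 0"
    "\<And>w. (\<Sum>i<k. e i *v w) = w"
    using direct_sum_projections[OF assms(4) sub] by blast
  interpret krull_schmidt_sum A U k e
    by unfold_locales (use assms(2,3) e in auto)
  obtain F where F: "finite F"
    "\<And>Q. Q \<in> F \<Longrightarrow> subspace Q \<and> (\<exists>p\<in>EndW A. \<exists>q\<in>EndW A.
          \<forall>x y. x *\<^sub>R p + y *\<^sub>R q \<in> Q \<longrightarrow> x = 0 \<and> y = 0)"
    and good: "\<And>L. L \<in> EndW A \<Longrightarrow>
      invertible L \<or> abs_indecomposable A (gen_ker L) \<longleftrightarrow> L \<notin> \<Union>F"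
    using bad_set_codim2_union by blast
  \<comment> \<open>From here on only a finite union of closed subspaces matters, to be avoided at
    every time.\<close>
  have gp: "general_position A l0 l1 L \<longleftrightarrow> (\<forall>t\<in>{l0<..<l1}. L t \<notin> \<Union>F)" if "C1_curve A l0 l1 L" for L
    using that good unfolding general_position_def C1_curve_def by blast
  have closed: "closed (\<Union>F)"
    using F closed_subspace by (intro closed_Union) auto
  show ?thesis
  proof (intro conjI allI impI; elim conjE)
    fix L assume L: "C1_curve A l0 l1 L" "general_position A l0 l1 L"
    obtain \<delta> where \<delta>: "pos_cont l0 l1 \<delta>"
      "\<And>M t. M \<in> C1_nbhd l0 l1 L \<delta> \<Longrightarrow> t \<in> {l0<..<l1} \<Longrightarrow> M t \<notin> \<Union>F"
      using C1_nbhd_avoids_closed[OF closed C1_curve_continuous_on[OF L(1)]] gp[OF L(1)] L(2) by metis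
    show "\<exists>\<delta>. pos_cont l0 l1 \<delta> \<and>
        (\<forall>M. C1_curve A l0 l1 M \<and> M \<in> C1_nbhd l0 l1 L \<delta> \<longrightarrow> general_position A l0 l1 M)"
      using \<delta> gp by (intro exI[of _ \<delta>]) simp
  next
    fix L \<delta> assume L: "C1_curve A l0 l1 L" and \<delta>: "pos_cont l0 l1 \<delta>"
    show "\<exists>M. C1_curve A l0 l1 M \<and> M \<in> C1_nbhd l0 l1 L \<delta> \<and> general_position A l0 l1 M"
      using C1_dense_avoids_codim2_union[OF F(1) assms(5) F(2) L \<delta>] gp by blast
  qed
qed

end
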